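(* For $0<q\le1$, there is no isomorphic embedding $L_{2,q}(0,\infty)\to L_{2,q}(0,1)$.
   Context: For $I=(0,1)$ or $I=(0,\infty)$ with Lebesgue measure $m$ and a measurable scalar function $f$ on $I$, $f^*(t)=\inf\{\lambda>0:m\{|f|>\lambda\}\le t\}$, $t>0$. For $0<q<\infty$, $L_{2,q}(I)$ is the space of measurable $f$ on $I$ with $\|f\|_{2,q}=\left(\int_0^\infty [t^{1/2}f^*(t)]^q\,\frac{dt}{t}\right)^{1/q}<\infty$ (a quasi-norm). An isomorphic embedding $T:X\to Y$ of quasi-Banach spaces is a linear map for which there is $C\ge1$ with $C^{-1}\|x\|_X\le\|Tx\|_Y\le C\|x\|_X$ for all $x\in X$. *)

theory Defs
  imports "HOL-Analysis.Analysis"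
begin

text \<open>
  The value is \<open>\<infinity>\<close> when no admissible \<open>l\<close> exists
  (infimum of the empty set in \<^typ>\<open>ennreal\<close>).
  Functions on \<open>I\<close> are total functions on \<^typ>\<open>real\<close>; everything below depends only on
  their values on \<open>I\<close>.
\<close>

definition rearrangement :: "real set \<Rightarrow> (real \<Rightarrow> 'a::real_normed_field) \<Rightarrow> real \<Rightarrow> ennreal" where
  "rearrangement I f t =
     Inf {ennreal l | l. 0 < l \<and> emeasure (lebesgue_on I) {x \<in> I. l < norm (f x)} \<le> ennreal t}"

text \<open>Only used with exponent \<open>a > 0\<close>, where \<open>\<infinity>\<close> to the power \<open>a\<close> is \<open>\<infinity>\<close>.\<close>

definition ennpowr :: "ennreal \<Rightarrow> real \<Rightarrow> ennreal" where
  "ennpowr x a = (if x = \<infinity> then \<infinity> else ennreal (enn2real x powr a))"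

definition L2q_qnorm :: "real \<Rightarrow> real set \<Rightarrow> (real \<Rightarrow> 'a::real_normed_field) \<Rightarrow> ennreal" where
  "L2q_qnorm q I f =
     ennpowr (\<integral>\<^sup>+t\<in>{0<..}. ennpowr (ennreal (t powr (1/2)) * rearrangement I f t) q * ennreal (1 / t) \<partial>lborel)
       (1 / q)"

definition L2q :: "real \<Rightarrow> real set \<Rightarrow> (real \<Rightarrow> 'a::real_normed_field) set" where
  "L2q q I = {f \<in> borel_measurable (lebesgue_on I). L2q_qnorm q I f < \<infinity>}"

text \<open>
  As usual, functions that agree almost everywhere are the same element of the space. A linear map
  between the spaces of classes is represented by a map on functions that respects equality almost
  everywhere and is linear over the scalar field \<^typ>\<open>'a\<close> up to equality almost everywhere.
  Only the values of \<open>T\<close> on \<open>L2q q I\<close> matter.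
\<close>

definition L2q_embedding ::
    "real \<Rightarrow> real set \<Rightarrow> real set \<Rightarrow> ((real \<Rightarrow> 'a::real_normed_field) \<Rightarrow> (real \<Rightarrow> 'a)) \<Rightarrow> bool" where
  "L2q_embedding q I J T \<longleftrightarrow>
     (\<forall>f \<in> L2q q I. T f \<in> L2q q J) \<and>
     (\<forall>f \<in> L2q q I. \<forall>g \<in> L2q q I.
        (AE x in lebesgue_on I. f x = g x) \<longrightarrow> (AE x in lebesgue_on J. T f x = T g x)) \<and>
     (\<forall>f \<in> L2q q I. \<forall>g \<in> L2q q I. AE x in lebesgue_on J. T (\<lambda>y. f y + g y) x = T f x + T g x) \<and>
     (\<forall>c. \<forall>f \<in> L2q q I. AE x in lebesgue_on J. T (\<lambda>y. c * f y) x = c * T f x) \<and>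
     (\<exists>C \<ge> 1. \<forall>f \<in> L2q q I.
        ennreal (1 / C) * L2q_qnorm q I f \<le> L2q_qnorm q J (T f) \<and>
        L2q_qnorm q J (T f) \<le> ennreal C * L2q_qnorm q I f)"

end

theory Submission
  imports Defs "HOL-Library.Diagonal_Subsequence"
begin

text \<open>
  Put \<open>r = q / 2\<close>. Up to constants, the \<open>q\<close>-th power of the quasi-norm of \<open>f\<close> is the sum over \<open>k\<close> of
  \<open>(4^k m{|f| > 2^k})^r\<close>. Let \<open>f_i\<close> be the images under an embedding of the indicators of
  \<open>[i, i + 1)\<close>, which span a copy of the sequence space \<open>l_{2,q}\<close>.

  Khintchine's inequality bounds the square functions of finitely many \<open>f_i\<close> by
  the flat sums. Gliding humps then show that, after passing to a subsequence, the
  distributions of all \<open>f_i\<close> are dominated by that of one function of \<open>L_{2,q}\<close>.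

  Now take the sum over \<open>m\<close> blocks, the \<open>j\<close>-th consisting of \<open>4^(k_0 + j)\<close> functions with
  coefficients \<open>2^-(k_0 + j)\<close>: the \<open>q\<close>-th power of its quasi-norm is at least of order \<open>m\<close>, whichever
  functions are used. Choose signs and functions at random from a large set. Averaging over
  the choices only increases the sum above, because \<open>r < 1\<close> makes the power concave. On the
  other hand a truncated fourth moment estimate separates the averaged distribution into a part
  controlled by the square function, of order \<open>m^r\<close>, and the tails of the dominating function beyond
  \<open>2^k_0\<close>, of order \<open>\<epsilon> m\<close>. This is impossible for large \<open>m\<close>.
\<close>

subsection \<open>Random signed selections\<close>

text \<open>The upper estimate is available only for flat sums, and bounding a block sum block by
  block merely reproduces the order \<open>m\<close>. The gain comes from drawing each function of
  the \<open>j\<close>-th block from a pool of \<open>4^(m-j)\<close> candidates: in the averaged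
  square function all members of all pools then have the same weight. It is the square function of a
  flat sum of \<open>m * 4^(k0+m)\<close> functions with coefficient \<open>2^-(k0+m)\<close>, so
  its size is \<open>m^r\<close>. What separates the two intervals is the bottom of the scale. On a
  space of measure 1 the levels below 1 contribute a bounded amount, so only \<open>k >= 0\<close>
  matters, up to a summand 1. A function with coefficient \<open>2^-(k0+j)\<close> passes level
  \<open>2^k\<close> only where it exceeds \<open>2^(k+k0+j)\<close>, so single functions enter
  through far tails of the dominating sequence. On the half-line the low levels carry the whole
  quasi-norm of such sums of disjoint indicators. A fourth moment is used because at level
  \<open>2^k\<close> it meets the weight \<open>4^k / 16^k\<close>; the resulting geometric ratio
  1/4 keeps sums over \<open>k\<close> under control, whereas a second moment would give ratio
  1.\<close>

definition avg :: "'i set \<Rightarrow> ('i \<Rightarrow> real) \<Rightarrow> real" where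
  "avg S h = (\<Sum>s\<in>S. h s) / real (card S)"

lemma avg_mono: "(\<And>s. s \<in> S \<Longrightarrow> g s \<le> h s) \<Longrightarrow> avg S g \<le> avg S h"
  unfolding avg_def by (intro divide_right_mono sum_mono) auto

lemma avg_cong: "(\<And>s. s \<in> S \<Longrightarrow> g s = h s) \<Longrightarrow> avg S g = avg S h"
  unfolding avg_def by (metis sum.cong)

lemma avg_add: "avg S (\<lambda>s. g s + h s) = avg S g + avg S h"
  unfolding avg_def by (simp add: sum.distrib add_divide_distrib)

lemma avg_cmult: "avg S (\<lambda>s. c * h s) = c * avg S h"
  unfolding avg_def by (simp add: sum_distrib_left[symmetric])

lemma avg_mult_right: "avg S (\<lambda>s. h s * c) = avg S h * c"
  using avg_cmult[of S c h] by (simp only: mult.commute)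

lemma avg_sum: "avg S (\<lambda>s. \<Sum>i\<in>I. h i s) = (\<Sum>i\<in>I. avg S (h i))"
  unfolding avg_def by (subst sum.swap) (simp add: sum_divide_distrib)

lemma avg_const: "finite S \<Longrightarrow> S \<noteq> {} \<Longrightarrow> avg S (\<lambda>s. c) = c"
  unfolding avg_def by simp

lemma avg_nonneg: "(\<And>s. s \<in> S \<Longrightarrow> 0 \<le> h s) \<Longrightarrow> 0 \<le> avg S h"
  unfolding avg_def by (intro divide_nonneg_nonneg sum_nonneg) auto

lemma avg_Times: "avg (A \<times> B) h = avg A (\<lambda>a. avg B (\<lambda>b. h (a, b)))"
  unfolding avg_def
  by (simp add: sum.cartesian_product sum_divide_distrib[symmetric] card_cartesian_product
      mult.commute)

lemma avg_PiE_insert: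
  assumes "finite I" and "i \<notin> I"
  shows "avg (PiE (insert i I) A) h = avg (A i) (\<lambda>s. avg (PiE I A) (\<lambda>\<xi>. h (\<xi>(i := s))))"
proof -
  have inj: "inj_on (\<lambda>(y, g). g(i := y)) (A i \<times> PiE I A)"
    using inj_combinator[OF assms(2)] .
  have "avg (PiE (insert i I) A) h = avg (A i \<times> PiE I A) (\<lambda>(s, \<xi>). h (\<xi>(i := s)))"
    unfolding avg_def PiE_insert_eq
    by (subst sum.reindex[OF inj], subst card_image[OF inj]) (simp add: o_def case_prod_unfold)
  then show ?thesis
    by (simp add: avg_Times)
qed

lemma avg_PiE_coordinate:
  assumes "finite I" "i \<in> I" "\<And>i. i \<in> I \<Longrightarrow> finite (A i)" "\<And>i. i \<in> I \<Longrightarrow> A i \<noteq> {}"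
  shows "avg (PiE I A) (\<lambda>\<xi>. h (\<xi> i)) = avg (A i) h"
proof -
  have "avg (PiE (insert i (I - {i})) A) (\<lambda>\<xi>. h (\<xi> i)) =
        avg (A i) (\<lambda>s. avg (PiE (I - {i}) A) (\<lambda>\<xi>. h ((\<xi>(i := s)) i)))"
    using assms by (intro avg_PiE_insert) auto
  also have "\<dots> = avg (A i) h"
    using assms by (simp, subst avg_const) (auto simp: PiE_eq_empty_iff intro!: finite_PiE)
  finally show ?thesis
    using assms by (simp add: insert_absorb)
qed

text \<open>A selection picks, for each index \<open>i\<close>, an element of \<open>S i\<close> and a sign.\<close>

abbreviation selections :: "'i set \<Rightarrow> ('i \<Rightarrow> 's set) \<Rightarrow> ('i \<Rightarrow> 's \<times> real) set" where
  "selections I S \<equiv> PiE I (\<lambda>i. S i \<times> {-1, 1})"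

definition rsum :: "('i \<Rightarrow> 's \<Rightarrow> 'a::real_vector) \<Rightarrow> 'i set \<Rightarrow> ('i \<Rightarrow> 's \<times> real) \<Rightarrow> 'a" where
  "rsum x I \<xi> = (\<Sum>i\<in>I. snd (\<xi> i) *\<^sub>R x i (fst (\<xi> i)))"

lemma avg_signs: "avg {-1, 1} h = (h (-1) + h (1::real)) / 2"
  unfolding avg_def by simp

lemma rsum_insert:
  assumes "finite I" "i \<notin> I"
  shows "rsum x (insert i I) (\<xi>(i := (s, e))) = rsum x I \<xi> + e *\<^sub>R x i s"
proof -
  have "(\<Sum>j\<in>I. snd ((\<xi>(i := (s, e))) j) *\<^sub>R x j (fst ((\<xi>(i := (s, e))) j))) = rsum x I \<xi>"
    unfolding rsum_def using assms by (intro sum.cong) auto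
  then show ?thesis
    using assms by (simp add: rsum_def add.commute)
qed

lemma avg_swap: "avg A (\<lambda>a. avg B (\<lambda>b. h a b)) = avg B (\<lambda>b. avg A (\<lambda>a. h a b))"
  unfolding avg_def by (simp add: sum_divide_distrib[symmetric] mult.commute) (subst sum.swap, simp)

text \<open>The induction step of all moment computations: with the other coordinates fixed,
  averaging the last sign replaces \<open>h\<close> by a symmetric mean, to which the parallelogram
  law applies.\<close>

lemma avg_selections_insert:
  assumes "finite I" "i \<notin> I"
  shows "avg (selections (insert i I) S) (\<lambda>\<xi>. h (rsum x (insert i I) \<xi>)) =
    avg (S i) (\<lambda>s. avg (selections I S)
      (\<lambda>\<xi>. (h (rsum x I \<xi> + x i s) + h (rsum x I \<xi> - x i s)) / 2))"
proof -
  have "avg (selections (insert i I) S) (\<lambda>\<xi>. h (rsum x (insert i I) \<xi>)) =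
    avg (S i) (\<lambda>s. avg {-1,1} (\<lambda>e. avg (selections I S) (\<lambda>\<xi>. h (rsum x I \<xi> + e *\<^sub>R x i s))))"
    by (simp add: avg_PiE_insert[OF assms] avg_Times rsum_insert[OF assms])
  also have "\<dots> = avg (S i) (\<lambda>s. avg (selections I S)
      (\<lambda>\<xi>. avg {-1,1} (\<lambda>e. h (rsum x I \<xi> + e *\<^sub>R x i s))))"
    by (intro avg_cong avg_swap)
  finally show ?thesis
    by (simp add: avg_signs add.commute)
qed

section \<open>Second and fourth moments of random signed sums\<close>

lemma second_moment:
  fixes x :: "'i \<Rightarrow> 's \<Rightarrow> 'a::real_inner"
  assumes "finite I" "\<And>i. i \<in> I \<Longrightarrow> finite (S i)" "\<And>i. i \<in> I \<Longrightarrow> S i \<noteq> {}"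
  shows "avg (selections I S) (\<lambda>\<xi>. norm (rsum x I \<xi>) ^ 2) =
    (\<Sum>i\<in>I. avg (S i) (\<lambda>s. norm (x i s) ^ 2))"
  using assms
proof (induction I rule: finite_induct)
  case empty
  then show ?case by (simp add: rsum_def avg_def)
next
  case (insert i I)
  have par: "(norm (y + z)^2 + norm (y - z)^2) / 2 = norm y ^ 2 + norm z ^ 2" for y z :: 'a
    by (simp add: power2_norm_eq_inner inner_add_left inner_add_right inner_diff_left
        inner_diff_right field_simps)
  have fin: "finite (selections I S)" "selections I S \<noteq> {}" "finite (S i)" "S i \<noteq> {}"
    using insert.prems insert.hyps by (auto intro!: finite_PiE simp: PiE_eq_empty_iff)
  show ?case
    using insert fin
    by (simp add: avg_selections_insert[of _ _ _ "\<lambda>v. norm v ^ 2"] par avg_add avg_const)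
qed

text \<open>With \<open>u = |y|^2 + |z|^2\<close> and \<open>c = 2 <y,z>\<close> the left side is
  \<open>u^2 + c^2\<close>, and Cauchy-Schwarz gives \<open>c^2 <= 4 |y|^2 |z|^2\<close>; hence the
  6 = 2 + 4.\<close>

lemma fourth_power_parallelogram:
  fixes y z :: "'a::real_inner"
  shows "(norm (y + z) ^ 4 + norm (y - z) ^ 4) / 2 \<le> norm y ^ 4 + 6 * (norm y ^ 2 * norm z ^ 2)
      + norm z ^ 4"
proof -
  have p: "norm (y + z) ^ 2 = norm y ^ 2 + norm z ^ 2 + 2 * inner y z"
    "norm (y - z) ^ 2 = norm y ^ 2 + norm z ^ 2 - 2 * inner y z"
    by (simp_all add: power2_norm_eq_inner inner_add_left inner_add_right inner_diff_left
        inner_diff_right inner_commute)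
  have four: "v ^ 4 = (v ^ 2) ^ 2" for v :: real
    by simp
  have cs: "(inner y z) ^ 2 \<le> norm y ^ 2 * norm z ^ 2"
    using Cauchy_Schwarz_ineq[of y z] by (simp add: power2_norm_eq_inner)
  show ?thesis
    unfolding four p using cs by (simp add: power2_eq_square algebra_simps)
qed

text \<open>The constant 3 makes the induction close: the new mixed term \<open>6 V v\<close> is
  exactly the one in \<open>3 (V + v)^2\<close>. The separate sum of fourth powers is kept because a
  randomly chosen \<open>x i s\<close> may have a fourth moment far larger than the square of its
  second moment.\<close>

lemma fourth_moment:
  fixes x :: "'i \<Rightarrow> 's \<Rightarrow> 'a::real_inner"
  assumes "finite I" "\<And>i. i \<in> I \<Longrightarrow> finite (S i)" "\<And>i. i \<in> I \<Longrightarrow> S i \<noteq> {}"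
  shows "avg (selections I S) (\<lambda>\<xi>. norm (rsum x I \<xi>) ^ 4) \<le>
    3 * (\<Sum>i\<in>I. avg (S i) (\<lambda>s. norm (x i s) ^ 2)) ^ 2 + (\<Sum>i\<in>I. avg (S i) (\<lambda>s. norm (x i s) ^ 4))"
  using assms
proof (induction I rule: finite_induct)
  case empty
  then show ?case by (simp add: rsum_def avg_def)
next
  case (insert i I)
  define V where "V = (\<Sum>i\<in>I. avg (S i) (\<lambda>s. norm (x i s) ^ 2))"
  define v where "v = avg (S i) (\<lambda>s. norm (x i s) ^ 2)"
  define W where "W = (\<Sum>i\<in>I. avg (S i) (\<lambda>s. norm (x i s) ^ 4))"
  have fin: "finite (selections I S)" "selections I S \<noteq> {}" "finite (S i)" "S i \<noteq> {}"
    using insert.prems insert.hyps by (auto intro!: finite_PiE simp: PiE_eq_empty_iff)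
  have sm: "avg (selections I S) (\<lambda>\<xi>. norm (rsum x I \<xi>) ^ 2) = V"
    unfolding V_def using insert by (intro second_moment) auto
  have IH: "avg (selections I S) (\<lambda>\<xi>. norm (rsum x I \<xi>) ^ 4) \<le> 3 * V^2 + W"
    unfolding V_def W_def using insert by auto
  have "avg (selections (insert i I) S) (\<lambda>\<xi>. norm (rsum x (insert i I) \<xi>) ^ 4) \<le>
    avg (S i) (\<lambda>s. avg (selections I S) (\<lambda>\<xi>. norm (rsum x I \<xi>) ^ 4 +
      6 * (norm (rsum x I \<xi>) ^ 2 * norm (x i s) ^ 2) + norm (x i s) ^ 4))"
    unfolding avg_selections_insert[OF insert.hyps, of _ "\<lambda>v. norm v ^ 4"]
    by (intro avg_mono fourth_power_parallelogram)
  also have "\<dots> = avg (selections I S) (\<lambda>\<xi>. norm (rsum x I \<xi>) ^ 4) + 6 * (V * v) +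
      avg (S i) (\<lambda>s. norm (x i s) ^ 4)"
    by (simp only: avg_add avg_cmult avg_mult_right avg_const[OF fin(1,2)] avg_const[OF fin(3,4)]
        sm v_def)
  also have "\<dots> \<le> 3 * (V + v)^2 + W + avg (S i) (\<lambda>s. norm (x i s) ^ 4)"
  proof -
    have "3 * (V + v)^2 = 3 * V^2 + 6 * (V * v) + 3 * v^2"
      by (simp add: power2_eq_square algebra_simps)
    then show ?thesis using IH zero_le_power2[of v] by linarith
  qed
  finally show ?case
    using insert.hyps by (simp add: V_def v_def W_def add_ac)
qed

text \<open>Pools \<open>{()}\<close> leave only the signs random. The second moment is
  \<open>V\<close> and the fourth at most \<open>4 V^2\<close>, so the sum cannot be small for
  nearly all signs.\<close>

lemma paley_zygmund:
  fixes x :: "'i \<Rightarrow> 'a::real_inner"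
  assumes "finite I" and V: "V = (\<Sum>i\<in>I. norm (x i) ^ 2)" "0 < V"
  shows "1 / 8 \<le> avg (selections I (\<lambda>_. {()})) (\<lambda>\<xi>. of_bool (V / 4 < norm (rsum (\<lambda>i _. x i) I \<xi>) ^ 2))"
    (is "_ \<le> avg ?\<Omega> (\<lambda>\<xi>. of_bool (_ < norm (?X \<xi>) ^ 2))")
proof -
  have fin: "finite ?\<Omega>" "?\<Omega> \<noteq> {}"
    using assms by (auto intro!: finite_PiE simp: PiE_eq_empty_iff)
  have sm: "avg ?\<Omega> (\<lambda>\<xi>. norm (?X \<xi>) ^ 2) = V"
    using second_moment[of I "\<lambda>_. {()}" "\<lambda>i _. x i"] assms by (simp add: avg_def)
  have "(\<Sum>i\<in>I. norm (x i) ^ 4) \<le> (\<Sum>i\<in>I. norm (x i) ^ 2 * V)"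
  proof (rule sum_mono)
    fix i assume "i \<in> I"
    then have "norm (x i) ^ 2 \<le> V"
      unfolding V using assms by (intro member_le_sum) auto
    then have "norm (x i) ^ 2 * norm (x i) ^ 2 \<le> norm (x i) ^ 2 * V"
      by (intro mult_left_mono) auto
    then show "norm (x i) ^ 4 \<le> norm (x i) ^ 2 * V"
      by (simp flip: power_add)
  qed
  also have "\<dots> = V * V"
    unfolding V(1) by (simp add: sum_distrib_right)
  finally have fm: "avg ?\<Omega> (\<lambda>\<xi>. norm (?X \<xi>) ^ 4) \<le> 4 * V^2"
    using fourth_moment[of I "\<lambda>_. {()}" "\<lambda>i _. x i"] assms
    by (simp add: avg_def power2_eq_square)
  \<comment> \<open>With \<open>u\<close> the squared norm, the case above the threshold is
    \<open>(u - 4 V)^2 >= 0\<close> divided by \<open>8 V\<close>. Averaging turns the fourth-moment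
    term into at most \<open>V / 2\<close>, so \<open>V / 4\<close> is left for \<open>2 V\<close>
    times the probability.\<close>
  have "norm (?X \<xi>) ^ 2 \<le> V / 4 + (1 / (8 * V)) * norm (?X \<xi>) ^ 4
      + 2 * V * of_bool (V / 4 < norm (?X \<xi>) ^ 2)" for \<xi>
  proof (cases "V / 4 < norm (?X \<xi>) ^ 2")
    case True
    define u where "u = norm (?X \<xi>) ^ 2"
    have "0 \<le> (u - 4 * V)^2 / (8 * V)"
      using V by simp
    also have "\<dots> = (1 / (8 * V)) * u^2 + 2 * V - u"
      using V by (simp add: field_simps power2_eq_square)
    finally show ?thesis
      using True V by (simp add: u_def flip: power_mult)
  next
    case False
    then show ?thesis using V by (simp add: add_increasing2)
  qed
  then have "avg ?\<Omega> (\<lambda>\<xi>. norm (?X \<xi>) ^ 2) \<le> avg ?\<Omega> (\<lambda>\<xi>. V / 4 + (1 / (8 * V)) * norm (?X \<xi>) ^ 4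
      + 2 * V * of_bool (V / 4 < norm (?X \<xi>) ^ 2))"
    by (intro avg_mono)
  also have "\<dots> = V / 4 + (1 / (8 * V)) * avg ?\<Omega> (\<lambda>\<xi>. norm (?X \<xi>) ^ 4)
      + 2 * V * avg ?\<Omega> (\<lambda>\<xi>. of_bool (V / 4 < norm (?X \<xi>) ^ 2))"
    by (simp only: avg_add avg_cmult avg_const[OF fin])
  also have "\<dots> \<le> V / 4 + (1 / (8 * V)) * (4 * V^2)
      + 2 * V * avg ?\<Omega> (\<lambda>\<xi>. of_bool (V / 4 < norm (?X \<xi>) ^ 2))"
    using V fm by (intro add_mono mult_left_mono) auto
  also have "\<dots> = V * (3 / 4 + 2 * avg ?\<Omega> (\<lambda>\<xi>. of_bool (V / 4 < norm (?X \<xi>) ^ 2)))"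
    using V by (simp add: field_simps power2_eq_square)
  finally show ?thesis
    using V sm by simp
qed

section \<open>Tails of signed sums by truncation at a dyadic level\<close>

lemma power2_power4: "(2 ^ k) ^ 4 = (16 ^ k :: real)"
proof -
  have "(2 ^ k) ^ 4 = ((2 ^ 4) ^ k :: real)"
    by (metis power_mult mult.commute)
  then show ?thesis by simp
qed

text \<open>
  A combination of superlevel indicators that dominates the
  truncated fourth moment at level \<open>2^k\<close>, so that distributions suffice to integrate it.
\<close>

definition hardy :: "nat \<Rightarrow> 'a::real_normed_vector \<Rightarrow> real" where
  "hardy k v = (1 + 17 * (\<Sum>l\<le>k. 16 ^ l * of_bool (2 ^ l < norm v))) / 16 ^ k"

text \<open>A layer-cake estimate: on \<open>2^l < |v| <= 2^(l+1)\<close> the fourth power is at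
  most \<open>16 * 16^l\<close>, and on \<open>|v| <= 1\<close> at most 1. The 17 is this 16 plus 1
  for the indicator of the top level.\<close>

lemma hardy_ge:
  "of_bool (2 ^ k < norm v) + norm v ^ 4 * of_bool (norm v \<le> 2 ^ k) / 16 ^ k \<le> hardy k v"
proof -
  have "norm v ^ 4 * of_bool (norm v \<le> 2 ^ k) \<le> 1 + 16 * (\<Sum>l<k. 16 ^ l * of_bool (2 ^ l < norm v))"
  proof (induction k)
    case 0
    then show ?case by (auto simp: power_le_one)
  next
    case (Suc k)
    show ?case
    proof (cases "norm v \<le> 2 ^ k")
      case True
      moreover from this have "norm v \<le> 2 ^ Suc k"
        by (rule order_trans) simp
      ultimately show ?thesis using Suc by simp
    next
      case False
      have "norm v ^ 4 \<le> (2 ^ Suc k) ^ 4" if "norm v \<le> 2 ^ Suc k"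
        using that by (intro power_mono) auto
      also have "(2 ^ Suc k) ^ 4 = (16 * 16 ^ k :: real)"
        by (simp add: power2_power4 power_mult_distrib)
      finally show ?thesis
        using False by (auto simp: sum_nonneg add_increasing)
    qed
  qed
  then have "16 ^ k * of_bool (2 ^ k < norm v) + norm v ^ 4 * of_bool (norm v \<le> 2 ^ k)
     \<le> 1 + 17 * (\<Sum>l\<le>k. 16 ^ l * of_bool (2 ^ l < norm v))"
    using sum_nonneg[of "{..<k}" "\<lambda>l. 16 ^ l * of_bool (2 ^ l < norm v) :: real"]
    by (simp add: lessThan_Suc_atMost[symmetric]) (auto simp: add_increasing)
  then have "(16 ^ k * of_bool (2 ^ k < norm v) + norm v ^ 4 * of_bool (norm v \<le> 2 ^ k)) / 16 ^ k
      \<le> hardy k v"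
    unfolding hardy_def by (intro divide_right_mono) auto
  then show ?thesis
    by (simp only: add_divide_distrib) simp
qed

text \<open>Either some summand exceeds \<open>2^k\<close>, or the sum agrees with the sum of the
  truncated summands, to which Markov's inequality for the fourth power applies. For each
  \<open>i\<close> the large-summand indicator and the truncated fourth power combine into one
  \<open>hardy\<close> term; the coefficient \<open>2^-p\<close> shifts its level from
  \<open>k\<close> to \<open>k + p\<close>.\<close>

lemma rsum_tail:
  fixes f :: "'i \<Rightarrow> 's \<Rightarrow> 'a::real_inner" and p :: "'i \<Rightarrow> nat"
  assumes I: "finite I" "\<And>i. i \<in> I \<Longrightarrow> finite (S i)" "\<And>i. i \<in> I \<Longrightarrow> S i \<noteq> {}"
    and V: "V = (\<Sum>i\<in>I. avg (S i) (\<lambda>s. norm (f i s) ^ 2) / 4 ^ p i)"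
  shows "avg (selections I S) (\<lambda>\<xi>. of_bool (2 ^ k < norm (rsum (\<lambda>i s. (1 / 2 ^ p i) *\<^sub>R f i s) I \<xi>)))
    \<le> (\<Sum>i\<in>I. avg (S i) (\<lambda>s. hardy (k + p i) (f i s))) + 3 * hardy k (sqrt V)"
proof -
  define x where "x i s = (1 / 2 ^ p i) *\<^sub>R f i s" for i s
  define y where "y i s = (if norm (x i s) \<le> 2 ^ k then x i s else 0)" for i s
  let ?\<Omega> = "selections I S"
  have fin: "finite ?\<Omega>" "?\<Omega> \<noteq> {}"
    using I by (auto intro!: finite_PiE simp: PiE_eq_empty_iff)
  define U where "U = (\<Sum>i\<in>I. avg (S i) (\<lambda>s. norm (y i s) ^ 2))"
  have V0: "0 \<le> V" unfolding V by (intro sum_nonneg divide_nonneg_nonneg avg_nonneg) auto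
  have U0: "0 \<le> U" unfolding U_def by (intro sum_nonneg avg_nonneg) auto
  have y_le: "norm (y i s) ^ 2 \<le> (1 / 4 ^ p i) * norm (f i s) ^ 2" for i s
    by (simp add: y_def x_def power_divide power2_eq_square[of "2 ^ p i"] flip: power_mult_distrib)
  have "avg (S i) (\<lambda>s. norm (y i s) ^ 2) \<le> (1 / 4 ^ p i) * avg (S i) (\<lambda>s. norm (f i s) ^ 2)" for i
    unfolding avg_cmult[symmetric] by (intro avg_mono y_le)
  then have UV: "U \<le> V"
    unfolding U_def V by (intro sum_mono) simp
  have "avg ?\<Omega> (\<lambda>\<xi>. of_bool (2 ^ k < norm (rsum y I \<xi>)))
      \<le> avg ?\<Omega> (\<lambda>\<xi>. (1 / 16 ^ k) * norm (rsum y I \<xi>) ^ 4)"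
  proof (rule avg_mono)
    fix \<xi>
    have "(2 ^ k) ^ 4 \<le> norm (rsum y I \<xi>) ^ 4" if "2 ^ k < norm (rsum y I \<xi>)"
      using that by (intro power_mono) auto
    then show "of_bool (2 ^ k < norm (rsum y I \<xi>)) \<le> (1 / 16 ^ k) * norm (rsum y I \<xi>) ^ 4"
      by (auto simp: field_simps power2_power4)
  qed
  also have "\<dots> \<le> (1 / 16 ^ k) * (3 * U ^ 2 + (\<Sum>i\<in>I. avg (S i) (\<lambda>s. norm (y i s) ^ 4)))"
    unfolding avg_cmult U_def using I by (intro mult_left_mono fourth_moment) auto
  also have "\<dots> \<le> 3 * V^2 / 16 ^ k + (\<Sum>i\<in>I. avg (S i) (\<lambda>s. norm (y i s) ^ 4 / 16 ^ k))"
  proof -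
    have "U ^ 2 \<le> V ^ 2" using UV U0 by (intro power_mono) auto
    moreover have "avg (S i) (\<lambda>s. norm (y i s) ^ 4 / 16 ^ k)
        = avg (S i) (\<lambda>s. norm (y i s) ^ 4) / 16 ^ k" for i
      using avg_cmult[of "S i" "1 / 16 ^ k"] by simp
    ultimately show ?thesis
      by (simp add: divide_right_mono flip: sum_divide_distrib add_divide_distrib)
  qed
  finally have m1: "avg ?\<Omega> (\<lambda>\<xi>. of_bool (2 ^ k < norm (rsum y I \<xi>))) \<le> \<dots>" .
  have m2: "avg ?\<Omega> (\<lambda>\<xi>. of_bool (2 ^ k < norm (rsum y I \<xi>))) \<le> 1"
    using avg_mono[of ?\<Omega> "\<lambda>\<xi>. of_bool (2 ^ k < norm (rsum y I \<xi>))" "\<lambda>_. 1"] fin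
        by (simp add: avg_const)
  have W0: "0 \<le> (\<Sum>i\<in>I. avg (S i) (\<lambda>s. norm (y i s) ^ 4 / 16 ^ k))"
    by (intro sum_nonneg avg_nonneg) auto
  \<comment> \<open>The cap by 1, legitimate for a probability, matters when
    \<open>sqrt V > 2^k\<close>: there \<open>hardy k (sqrt V)\<close> is only known to be at least
    1, while \<open>V^2 / 16^k\<close> may be huge.\<close>
  have hV: "min 1 (3 * V^2 / 16 ^ k) \<le> 3 * hardy k (sqrt V)"
  proof -
    have "sqrt V ^ 4 = V ^ 2"
      using V0 power_mult[of "sqrt V" 2 2] by simp
    show ?thesis
    proof (cases "2 ^ k < sqrt V")
      case True
      then have "1 \<le> hardy k (sqrt V)"
        using hardy_ge[of k "sqrt V"] V0 by simp
      then show ?thesis by linarith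
    next
      case False
      then have "V^2 / 16 ^ k \<le> hardy k (sqrt V)"
        using hardy_ge[of k "sqrt V"] V0 \<open>sqrt V ^ 4 = V ^ 2\<close> by simp
      then have "3 * V^2 / 16 ^ k \<le> 3 * hardy k (sqrt V)" by linarith
      then show ?thesis by linarith
    qed
  qed
  have m3: "avg ?\<Omega> (\<lambda>\<xi>. of_bool (2 ^ k < norm (rsum y I \<xi>))) \<le>
      3 * hardy k (sqrt V) + (\<Sum>i\<in>I. avg (S i) (\<lambda>s. norm (y i s) ^ 4 / 16 ^ k))"
    using m1 m2 W0 hV by linarith
  have "avg ?\<Omega> (\<lambda>\<xi>. of_bool (2 ^ k < norm (rsum x I \<xi>))) \<le>
      avg ?\<Omega> (\<lambda>\<xi>. (\<Sum>i\<in>I. of_bool (2 ^ k < norm (x i (fst (\<xi> i)))))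
          + of_bool (2 ^ k < norm (rsum y I \<xi>)))"
  proof (rule avg_mono)
    fix \<xi>
    show "of_bool (2 ^ k < norm (rsum x I \<xi>)) \<le>
        (\<Sum>i\<in>I. of_bool (2 ^ k < norm (x i (fst (\<xi> i)))))
            + (of_bool (2 ^ k < norm (rsum y I \<xi>)) :: real)"
    proof (cases "\<exists>i\<in>I. 2 ^ k < norm (x i (fst (\<xi> i)))")
      case True
      then obtain i where i: "i \<in> I" "2 ^ k < norm (x i (fst (\<xi> i)))" by blast
      have "(1::real) = of_bool (2 ^ k < norm (x i (fst (\<xi> i))))"
        using i by simp
      also have "\<dots> \<le> (\<Sum>i\<in>I. of_bool (2 ^ k < norm (x i (fst (\<xi> i)))))"
        using i I by (intro member_le_sum) auto
      finally show ?thesis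
        by (smt (verit) of_bool_eq)
    next
      case False
      then have "rsum x I \<xi> = rsum y I \<xi>"
        unfolding rsum_def y_def by (intro sum.cong) (auto simp: not_less)
      then show ?thesis by (simp add: sum_nonneg)
    qed
  qed
  also have "\<dots> = (\<Sum>i\<in>I. avg (S i) (\<lambda>s. of_bool (2 ^ k < norm (x i s)))) +
      avg ?\<Omega> (\<lambda>\<xi>. of_bool (2 ^ k < norm (rsum y I \<xi>)))"
  proof -
    have "avg ?\<Omega> (\<lambda>\<xi>. of_bool (2 ^ k < norm (x i (fst (\<xi> i)))))
        = avg (S i) (\<lambda>s. of_bool (2 ^ k < norm (x i s)))"
      if "i \<in> I" for i
      using avg_PiE_coordinate[of I i "\<lambda>i. S i \<times> {-1, 1::real}" "\<lambda>u. of_bool (2 ^ k < norm (x i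
          (fst u)))"] I that
      by (simp add: avg_Times avg_const)
    then show ?thesis by (simp add: avg_add avg_sum)
  qed
  also have "\<dots> \<le> (\<Sum>i\<in>I. avg (S i) (\<lambda>s. of_bool (2 ^ k < norm (x i s))
      + norm (y i s) ^ 4 / 16 ^ k)) + 3 * hardy k (sqrt V)"
    using m3 by (simp add: avg_add sum.distrib)
  also have "\<dots> \<le> (\<Sum>i\<in>I. avg (S i) (\<lambda>s. hardy (k + p i) (f i s))) + 3 * hardy k (sqrt V)"
  proof (intro add_right_mono sum_mono avg_mono)
    fix i s
    have nx: "norm (x i s) = norm (f i s) / 2 ^ p i" by (simp add: x_def)
    have "of_bool (2 ^ k < norm (x i s)) + norm (y i s) ^ 4 / 16 ^ k =
       of_bool (2 ^ (k + p i) < norm (f i s)) + norm (f i s) ^ 4 * of_bool (norm (f i s) \<le> 2 ^ (k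
           + p i)) / 16 ^ (k + p i)"
      by (auto simp: y_def nx power_add power_divide power2_power4 field_simps)
    then show "of_bool (2 ^ k < norm (x i s)) + norm (y i s) ^ 4 / 16 ^ k \<le> hardy (k + p i) (f i s)"
      using hardy_ge by metis
  qed
  finally show ?thesis unfolding x_def .
qed

subsection \<open>Powers and tails of distributions\<close>

lemma powr_add_le:
  fixes x y r :: real
  assumes "0 \<le> x" "0 \<le> y" "0 \<le> r" "r \<le> 1"
  shows "(x + y) powr r \<le> x powr r + y powr r"
proof (cases "x + y = 0")
  case True
  then show ?thesis using assms by simp
next
  case False
  then have s: "0 < x + y" using assms by simp
  have *: "u / (x + y) \<le> u powr r / (x + y) powr r" if "0 \<le> u" "u \<le> x + y" for u
  proof (cases "u = 0")
    case False
    then have "(u / (x + y)) powr 1 \<le> (u / (x + y)) powr r"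
      using that s assms by (intro powr_mono') auto
    then show ?thesis using that s False by (simp add: powr_divide)
  qed (use assms in simp)
  have "1 = x / (x + y) + y / (x + y)"
    using s by (simp add: add_divide_distrib[symmetric])
  also have "\<dots> \<le> (x powr r + y powr r) / (x + y) powr r"
    unfolding add_divide_distrib using assms by (intro add_mono *) auto
  finally show ?thesis using s by (simp add: field_simps)
qed

lemma powr_sum_le:
  fixes x :: "'i \<Rightarrow> real"
  assumes "finite I" "\<And>i. i \<in> I \<Longrightarrow> 0 \<le> x i" "0 < r" "r \<le> 1"
  shows "(\<Sum>i\<in>I. x i) powr r \<le> (\<Sum>i\<in>I. x i powr r)"
  using assms
proof (induction I rule: finite_induct)
  case (insert i I)
  have "(\<Sum>i\<in>insert i I. x i) powr r \<le> x i powr r + (\<Sum>i\<in>I. x i) powr r"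
    using insert by (simp add: powr_add_le sum_nonneg)
  then show ?case using insert by force
qed simp

text \<open>Jensen's inequality, from the tangent of the concave power at the mean.\<close>

lemma avg_powr_le:
  assumes "finite S" "S \<noteq> {}" "\<And>s. s \<in> S \<Longrightarrow> 0 \<le> h s" "0 < r" "r < 1"
  shows "avg S (\<lambda>s. h s powr r) \<le> avg S h powr r"
proof (cases "avg S h = 0")
  case True
  then have "\<forall>s\<in>S. h s = 0"
    using assms by (auto simp: avg_def sum_nonneg_eq_0_iff)
  then show ?thesis
    using assms by (simp add: avg_def)
next
  case False
  define z where "z = avg S h"
  have z: "0 < z"
    using False assms avg_nonneg[of S h] by (simp add: z_def)
  have "h s powr r \<le> (r * z powr (r - 1)) * h s + (1 - r) * z powr r" if "s \<in> S" for s
  proof -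
    have "h s powr r * z powr (1 - r) \<le> r * h s + (1 - r) * z"
      using Youngs_inequality_0[of r "1 - r" "h s" z] assms(3)[OF that] assms z by (cases "h s
          = 0") auto
    then have "z powr (r - 1) * (h s powr r * z powr (1 - r)) \<le> z powr (r - 1) * (r * h s
        + (1 - r) * z)"
      by (intro mult_left_mono) auto
    moreover have "z powr (r - 1) * z powr (1 - r) = 1" "z powr (r - 1) * z = z powr r"
      using z by (simp_all add: powr_add[symmetric] powr_mult_base' powr_minus_divide powr_diff)
    ultimately show ?thesis
      by (simp add: algebra_simps)
  qed
  then have "avg S (\<lambda>s. h s powr r) \<le> avg S (\<lambda>s. (r * z powr (r - 1)) * h s + (1 - r) * z powr r)"
    by (intro avg_mono)
  also have "\<dots> = (r * z powr (r - 1)) * z + (1 - r) * z powr r"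
    unfolding avg_add avg_cmult by (simp add: avg_const assms z_def)
  also have "\<dots> = z powr r"
    using z by (simp add: powr_diff algebra_simps)
  finally show ?thesis by (simp add: z_def)
qed

text \<open>A discrete Hardy operator with geometric kernel. It arises with ratio 1/4 when
  \<open>hardy k\<close> is integrated and weighted by \<open>4^k\<close>, and with ratio
  \<open>(1/4)^r\<close> once powers are taken; the leading term comes from values of norm at most
  1.\<close>

definition hardy_sum :: "real \<Rightarrow> (nat \<Rightarrow> real) \<Rightarrow> nat \<Rightarrow> real" where
  "hardy_sum \<theta> y k = \<theta> ^ k + 17 * (\<Sum>l\<le>k. \<theta> ^ (k - l) * y l)"

lemma hardy_sum_nonneg: "0 \<le> \<theta> \<Longrightarrow> (\<And>l. 0 \<le> y l) \<Longrightarrow> 0 \<le> hardy_sum \<theta> y k"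
  unfolding hardy_sum_def by (intro add_nonneg_nonneg mult_nonneg_nonneg sum_nonneg) auto

lemma hardy_sum_Suc: "hardy_sum \<theta> y (Suc k) = \<theta> * hardy_sum \<theta> y k + 17 * y (Suc k)"
proof -
  have "(\<Sum>l\<le>k. \<theta> ^ (Suc k - l) * y l) = \<theta> * (\<Sum>l\<le>k. \<theta> ^ (k - l) * y l)"
    by (simp add: sum_distrib_left Suc_diff_le mult.assoc)
  then show ?thesis
    unfolding hardy_sum_def by (simp add: algebra_simps)
qed

text \<open>The recursion \<open>hardy_sum_Suc\<close>, summed over \<open>k\<close>. It gives
  boundedness on summable sequences with constant \<open>1 / (1 - \<theta>)\<close>.\<close>

lemma hardy_sum_sum: "(1 - \<theta>) * (\<Sum>k\<le>n. hardy_sum \<theta> y k) + \<theta> * hardy_sum \<theta> y n = 1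
    + 17 * (\<Sum>k\<le>n. y k)"
proof (induction n)
  case (Suc n)
  then show ?case by (simp add: hardy_sum_Suc algebra_simps)
qed (simp add: hardy_sum_def algebra_simps)

lemma hardy_sum_sum_le:
  assumes "0 \<le> \<theta>" "\<theta> < 1" "\<And>l. 0 \<le> y l"
  shows "(\<Sum>k<n. hardy_sum \<theta> y k) \<le> (1 + 17 * (\<Sum>k<n. y k)) / (1 - \<theta>)"
proof (cases n)
  case (Suc m)
  have "(1 - \<theta>) * (\<Sum>k\<le>m. hardy_sum \<theta> y k) \<le> 1 + 17 * (\<Sum>k\<le>m. y k)"
    using hardy_sum_sum[of \<theta> y m] hardy_sum_nonneg[of \<theta> y m] assms
        by (smt (verit) mult_nonneg_nonneg)
  then show ?thesis
    using assms by (simp add: Suc lessThan_Suc_atMost field_simps)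
qed (use assms in simp)

lemma hardy_sum_summable:
  assumes "0 \<le> \<theta>" "\<theta> < 1" "\<And>l. 0 \<le> y l" "summable y"
  shows "summable (hardy_sum \<theta> y)"
proof (rule summableI_nonneg_bounded)
  show "0 \<le> hardy_sum \<theta> y k" for k using assms by (intro hardy_sum_nonneg) auto
  show "(\<Sum>k<n. hardy_sum \<theta> y k) \<le> (1 + 17 * suminf y) / (1 - \<theta>)" for n
  proof -
    have "(\<Sum>k<n. y k) \<le> suminf y"
      using assms by (intro sum_le_suminf) auto
    then show ?thesis
      using assms by (intro order_trans[OF hardy_sum_sum_le] divide_right_mono) auto
  qed
qed

lemma hardy_sum_mono: "0 \<le> \<theta> \<Longrightarrow> (\<And>l. y l \<le> z l) \<Longrightarrow> hardy_sum \<theta> y k \<le> hardy_sum \<theta> z k"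
  unfolding hardy_sum_def by (intro add_left_mono mult_left_mono sum_mono) auto

text \<open>Subadditivity of the power acts on every term of the kernel. Weakening
  \<open>17 powr r\<close> to 17 makes the result a \<open>hardy_sum\<close> again.\<close>

lemma hardy_sum_powr_le:
  assumes "\<And>l. 0 \<le> a l" "\<And>l. a l powr r \<le> y l" "0 < r" "r < 1" "0 < \<theta>"
  shows "hardy_sum \<theta> a k powr r \<le> hardy_sum (\<theta> powr r) y k"
proof -
  have pw: "(\<theta> ^ n) powr r = (\<theta> powr r) ^ n" for n
    using assms by (induction n) (simp_all add: powr_mult)
  have "hardy_sum \<theta> a k powr r \<le> (\<theta> ^ k) powr r + (17 * (\<Sum>l\<le>k. \<theta> ^ (k - l) * a l)) powr r"
    unfolding hardy_sum_def using assms by (intro powr_add_le mult_nonneg_nonneg sum_nonneg) auto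
  also have "(17 * (\<Sum>l\<le>k. \<theta> ^ (k - l) * a l)) powr r = 17 powr r * (\<Sum>l\<le>k. \<theta> ^ (k - l) * a l) powr r"
    using assms by (intro powr_mult)
  also have "\<dots> \<le> 17 * (\<Sum>l\<le>k. (\<theta> ^ (k - l) * a l) powr r)"
    using assms powr_mono[of r 1 17] by (intro mult_mono powr_sum_le sum_nonneg) auto
  also have "(\<Sum>l\<le>k. (\<theta> ^ (k - l) * a l) powr r) \<le> (\<Sum>l\<le>k. (\<theta> powr r) ^ (k - l) * y l)"
    using assms by (intro sum_mono) (auto simp: powr_mult pw intro!: mult_left_mono)
  finally show ?thesis
    by (simp add: hardy_sum_def pw)
qed

section \<open>Distribution functions on a probability space\<close>

definition tail :: "'b measure \<Rightarrow> ('b \<Rightarrow> 'a::real_normed_vector) \<Rightarrow> real \<Rightarrow> real" where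
  "tail M f l = measure M {x \<in> space M. l < norm (f x)}"

lemma tail_nonneg: "0 \<le> tail M f l"
  by (simp add: tail_def)

context
  fixes M :: "'b measure"
  assumes M1: "finite_measure M" "measure M (space M) = 1"
begin

interpretation finite_measure M by (fact M1)

lemma tail_le_1: "tail M f l \<le> 1"
  unfolding tail_def using bounded_measure M1(2) by metis

lemma integrable_tail [intro]:
  fixes f :: "'b \<Rightarrow> 'a::real_normed_vector"
  assumes "f \<in> borel_measurable M"
  shows "integrable M (\<lambda>x. of_bool (l < norm (f x)) :: real)"
proof (rule integrable_const_bound[where B = 1])
  show "(\<lambda>x. of_bool (l < norm (f x)) :: real) \<in> borel_measurable M"
    using assms by measurable
qed auto

lemma tail_eq_integral:
  fixes f :: "'b \<Rightarrow> 'a::real_normed_vector"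
  assumes "f \<in> borel_measurable M"
  shows "tail M f l = (\<integral>x. of_bool (l < norm (f x)) \<partial>M)"
proof -
  have "{x \<in> space M. l < norm (f x)} \<in> sets M"
    using assms by measurable
  moreover have "(\<integral>x. of_bool (l < norm (f x)) \<partial>M)
      = (\<integral>x. indicator {x \<in> space M. l < norm (f x)} x \<partial>M :: real)"
    by (intro Bochner_Integration.integral_cong) (auto simp: indicator_def)
  moreover have "{x \<in> space M. l < norm (f x)} \<inter> space M = {x \<in> space M. l < norm (f x)}"
    by auto
  ultimately show ?thesis
    by (simp add: tail_def)
qed

lemma integral_avg:
  assumes "\<And>s. s \<in> S \<Longrightarrow> integrable M (h s)"
  shows "integrable M (\<lambda>x. avg S (\<lambda>s. h s x))" "(\<integral>x. avg S (\<lambda>s. h s x) \<partial>M)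
      = avg S (\<lambda>s. \<integral>x. h s x \<partial>M)"
  using assms unfolding avg_def by simp_all

lemma integral_hardy:
  fixes f :: "'b \<Rightarrow> 'a::real_normed_vector"
  assumes f: "f \<in> borel_measurable M"
  shows "integrable M (\<lambda>x. hardy k (f x))"
    "4 ^ k * (\<integral>x. hardy k (f x) \<partial>M) = hardy_sum (1 / 4) (\<lambda>l. 4 ^ l * tail M f (2 ^ l)) k"
proof -
  have i: "integrable M (\<lambda>x. (\<Sum>l\<le>k. 16 ^ l * of_bool (2 ^ l < norm (f x))) :: real)"
    using f by (intro Bochner_Integration.integrable_sum integrable_mult_right integrable_tail) auto
  then show "integrable M (\<lambda>x. hardy k (f x))"
    unfolding hardy_def by simp
  have "(\<integral>x. hardy k (f x) \<partial>M) = (1 + 17 * (\<Sum>l\<le>k. 16 ^ l * tail M f (2 ^ l))) / 16 ^ k"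
    unfolding hardy_def using i f
    by (simp add: tail_eq_integral Bochner_Integration.integral_sum integrable_tail M1
        del: sum_mult_of_bool_eq sum_of_bool_mult_eq)
  also have "4 ^ k * \<dots> = hardy_sum (1 / 4) (\<lambda>l. 4 ^ l * tail M f (2 ^ l)) k"
  proof -
    have s: "4 ^ k * (16 ^ l * u) / 16 ^ k = (1 / 4) ^ (k - l) * (4 ^ l * u)" if "l \<le> k" for l
        and u :: real
    proof -
      have "(16::real) ^ n = 4 ^ n * 4 ^ n" for n by (simp flip: power_mult_distrib)
      moreover have "(4::real) ^ k = 4 ^ (k - l) * 4 ^ l" using that by (simp flip: power_add)
      ultimately show ?thesis by (simp add: field_simps)
    qed
    have "4 ^ k * ((1 + 17 * (\<Sum>l\<le>k. 16 ^ l * tail M f (2 ^ l))) / 16 ^ k) =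
       4 ^ k / 16 ^ k + 17 * (\<Sum>l\<le>k. 4 ^ k * (16 ^ l * tail M f (2 ^ l)) / 16 ^ k)"
      by (simp add: sum_distrib_left sum_divide_distrib add_divide_distrib distrib_left mult_ac)
    also have "\<dots> = hardy_sum (1 / 4) (\<lambda>l. 4 ^ l * tail M f (2 ^ l)) k"
      unfolding hardy_sum_def using s by (simp flip: power_divide)
    finally show ?thesis .
  qed
  finally show "4 ^ k * (\<integral>x. hardy k (f x) \<partial>M)
      = hardy_sum (1 / 4) (\<lambda>l. 4 ^ l * tail M f (2 ^ l)) k" .
qed

lemma borel_measurable_rsum:
  fixes f :: "'i \<Rightarrow> 's \<Rightarrow> 'b \<Rightarrow> 'a::euclidean_space"
  assumes "\<And>i s. i \<in> I \<Longrightarrow> s \<in> S i \<Longrightarrow> f i s \<in> borel_measurable M" "\<xi> \<in> selections I S"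
  shows "(\<lambda>t. rsum (\<lambda>i s. f i s t) I \<xi>) \<in> borel_measurable M"
  unfolding rsum_def
proof (intro borel_measurable_sum borel_measurable_scaleR borel_measurable_const)
  fix i assume "i \<in> I"
  then have "fst (\<xi> i) \<in> S i" using assms(2) by (auto simp: PiE_iff mem_Times_iff)
  then show "f i (fst (\<xi> i)) \<in> borel_measurable M" using assms(1) \<open>i \<in> I\<close> by auto
qed

text \<open>\<open>rsum_tail\<close> integrated over the space. Since
  \<open>4^k = 4^(k+p) / 4^p\<close>, a function with coefficient \<open>2^-p\<close> contributes
  the Hardy sum at index \<open>k + p\<close> with weight \<open>4^-p\<close>; a block of
  \<open>4^p\<close> such functions thus costs one shifted Hardy sum.\<close>

lemma avg_tail_le:
  fixes f :: "'i \<Rightarrow> 's \<Rightarrow> 'b \<Rightarrow> 'a::euclidean_space" and p :: "'i \<Rightarrow> nat"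
  assumes I: "finite I" "\<And>i. i \<in> I \<Longrightarrow> finite (S i)" "\<And>i. i \<in> I \<Longrightarrow> S i \<noteq> {}"
    and meas: "\<And>i s. i \<in> I \<Longrightarrow> s \<in> S i \<Longrightarrow> f i s \<in> borel_measurable M"
    and V: "\<And>t. V t = (\<Sum>i\<in>I. avg (S i) (\<lambda>s. norm (f i s t) ^ 2) / 4 ^ p i)"
    and a: "\<And>i s l. i \<in> I \<Longrightarrow> s \<in> S i \<Longrightarrow> 4 ^ l * tail M (f i s) (2 ^ l) \<le> a l"
  shows "4 ^ k * avg (selections I S) (\<lambda>\<xi>. tail M (\<lambda>t. rsum (\<lambda>i s. (1 / 2 ^ p i) *\<^sub>R f i s t) I \<xi>)
      (2 ^ k))
    \<le> (\<Sum>i\<in>I. hardy_sum (1 / 4) a (k + p i) / 4 ^ p i)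
        + 3 * hardy_sum (1 / 4) (\<lambda>l. 4 ^ l * tail M (\<lambda>t. sqrt (V t)) (2 ^ l)) k"
proof -
  let ?\<Omega> = "selections I S"
  let ?X = "\<lambda>\<xi> t. rsum (\<lambda>i s. (1 / 2 ^ p i) *\<^sub>R f i s t) I \<xi>"
  have X: "?X \<xi> \<in> borel_measurable M" if "\<xi> \<in> ?\<Omega>" for \<xi>
    using that meas by (intro borel_measurable_rsum[where f
        = "\<lambda>i s t. (1 / 2 ^ p i) *\<^sub>R f i s t"]) auto
  have Vm: "(\<lambda>t. sqrt (V t)) \<in> borel_measurable M"
  proof -
    have "V \<in> borel_measurable M"
      unfolding V[abs_def] avg_def using meas
      by (intro borel_measurable_sum borel_measurable_divide borel_measurable_power
          borel_measurable_norm) auto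
    then show ?thesis by measurable
  qed
  have hi: "integrable M (\<lambda>t. avg (S i) (\<lambda>s. hardy (k + p i) (f i s t)))" if "i \<in> I" for i
    using that meas by (intro integral_avg integral_hardy) auto
  have "avg ?\<Omega> (\<lambda>\<xi>. tail M (?X \<xi>) (2 ^ k)) = avg ?\<Omega> (\<lambda>\<xi>. \<integral>t. of_bool (2 ^ k < norm (?X \<xi> t)) \<partial>M)"
    by (intro avg_cong tail_eq_integral X)
  also have "\<dots> = (\<integral>t. avg ?\<Omega> (\<lambda>\<xi>. of_bool (2 ^ k < norm (?X \<xi> t))) \<partial>M)"
    by (intro integral_avg(2)[symmetric] integrable_tail X)
  also have "\<dots> \<le> (\<integral>t. (\<Sum>i\<in>I. avg (S i) (\<lambda>s. hardy (k + p i) (f i s t)))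
      + 3 * hardy k (sqrt (V t)) \<partial>M)"
    using I V integral_hardy(1)[OF Vm]
    by (intro integral_mono integral_avg integrable_tail X rsum_tail
        Bochner_Integration.integrable_add
        Bochner_Integration.integrable_sum integrable_mult_right hi) auto
  also have "\<dots> = (\<Sum>i\<in>I. \<integral>t. avg (S i) (\<lambda>s. hardy (k + p i) (f i s t)) \<partial>M)
      + 3 * (\<integral>t. hardy k (sqrt (V t)) \<partial>M)"
    using integral_hardy(1)[OF Vm] hi
    by (simp add: Bochner_Integration.integral_add Bochner_Integration.integrable_sum
        Bochner_Integration.integral_sum)
  finally have "4 ^ k * avg ?\<Omega> (\<lambda>\<xi>. tail M (?X \<xi>) (2 ^ k)) \<le>
     4 ^ k * ((\<Sum>i\<in>I. \<integral>t. avg (S i) (\<lambda>s. hardy (k + p i) (f i s t)) \<partial>M)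
         + 3 * (\<integral>t. hardy k (sqrt (V t)) \<partial>M))"
    by (intro mult_left_mono) auto
  also have "\<dots> = (\<Sum>i\<in>I. 4 ^ k * (\<integral>t. avg (S i) (\<lambda>s. hardy (k + p i) (f i s t)) \<partial>M))
      + 3 * hardy_sum (1 / 4) (\<lambda>l. 4 ^ l * tail M (\<lambda>t. sqrt (V t)) (2 ^ l)) k"
    unfolding integral_hardy(2)[OF Vm, symmetric] by (simp add: sum_distrib_left distrib_left)
  also have "\<dots> \<le> (\<Sum>i\<in>I. hardy_sum (1 / 4) a (k + p i) / 4 ^ p i)
      + 3 * hardy_sum (1 / 4) (\<lambda>l. 4 ^ l * tail M (\<lambda>t. sqrt (V t)) (2 ^ l)) k"
  proof (intro add_right_mono sum_mono)
    fix i assume i: "i \<in> I"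
    have "4 ^ p i * (4 ^ k * (\<integral>t. avg (S i) (\<lambda>s. hardy (k + p i) (f i s t)) \<partial>M)) =
       avg (S i) (\<lambda>s. 4 ^ (k + p i) * (\<integral>t. hardy (k + p i) (f i s t) \<partial>M))"
      using i meas by (subst integral_avg(2)) (auto intro!: integral_hardy(1) simp: avg_cmult
          power_add)
    also have "\<dots> \<le> avg (S i) (\<lambda>s. hardy_sum (1 / 4) a (k + p i))"
      using i meas a by (intro avg_mono) (auto simp: integral_hardy(2) intro!: hardy_sum_mono)
    also have "\<dots> = hardy_sum (1 / 4) a (k + p i)"
      using I i by (intro avg_const) auto
    finally show "4 ^ k * (\<integral>t. avg (S i) (\<lambda>s. hardy (k + p i) (f i s t)) \<partial>M)
        \<le> hardy_sum (1 / 4) a (k + p i) / 4 ^ p i"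
      by (simp add: field_simps)
  qed
  finally show ?thesis .
qed

end

subsection \<open>Dominated subsequences\<close>

text \<open>The source of both contradictions: the gliding humps and the block sums each force
  linear growth under a bound of order \<open>m^r\<close>.\<close>

lemma powr_sublinear:
  fixes a b d r :: real
  assumes "0 < a" "r < 1"
  shows "\<exists>m::nat. d + b * real m powr r < a * real m"
proof -
  have "((\<lambda>x::real. (d + b * x powr r) / x) \<longlongrightarrow> 0) at_top"
  proof -
    have "((\<lambda>x::real. d / x + b * x powr (r - 1)) \<longlongrightarrow> 0 + b * 0) at_top"
      using assms by (intro tendsto_intros tendsto_neg_powr tendsto_divide_0[OF tendsto_const])
          (auto simp: filterlim_ident filterlim_at_top_imp_at_infinity)
    moreover have "\<forall>\<^sub>F x::real in at_top. d / x + b * x powr (r - 1) = (d + b * x powr r) / x"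
      using eventually_gt_at_top[of 0] by eventually_elim (simp add: powr_diff add_divide_distrib)
    ultimately show ?thesis
      by (simp add: filterlim_cong)
  qed
  then have "\<forall>\<^sub>F x in at_top. (d + b * x powr r) / x < a"
    using assms by (auto dest: order_tendstoD)
  then have "\<forall>\<^sub>F x::real in at_top. d + b * x powr r < a * x"
    using eventually_gt_at_top[of 0] by eventually_elim (simp add: divide_simps)
  then have "\<forall>\<^sub>F m in sequentially. d + b * real m powr r < a * real m"
    using filterlim_real_sequentially by (auto simp: filterlim_iff)
  then show ?thesis
    by (auto simp: eventually_sequentially)
qed

lemma coordinatewise_convergent_subsequence:
  fixes y :: "nat \<Rightarrow> nat \<Rightarrow> real"
  assumes "\<And>i k. \<bar>y i k\<bar> \<le> B k"
  shows "\<exists>\<tau> z. strict_mono \<tau> \<and> (\<forall>k. (\<lambda>i. y (\<tau> i) k) \<longlonglongrightarrow> z k)"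
proof -
  interpret subseqs "\<lambda>k \<tau>. convergent (\<lambda>i. y (\<tau> i) k)"
  proof
    fix k and \<tau> :: "nat \<Rightarrow> nat" assume "strict_mono \<tau>"
    have "bounded (range (\<lambda>i. y (\<tau> i) k))"
      using assms by (intro boundedI[of _ "B k"]) auto
    then obtain l \<rho> where "strict_mono \<rho>" "((\<lambda>i. y (\<tau> i) k) \<circ> \<rho>) \<longlonglongrightarrow> l"
      using bounded_imp_convergent_subsequence by blast
    then show "\<exists>\<rho>. strict_mono \<rho> \<and> convergent (\<lambda>i. y ((\<tau> \<circ> \<rho>) i) k)"
      by (auto simp: convergent_def o_def)
  qed
  have "convergent (\<lambda>i. y (diagseq i) k)" for k
  proof -
    have "convergent (\<lambda>i. y ((diagseq \<circ> (+) (Suc k)) i) k)"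
    proof (rule diagseq_holds)
      fix \<tau> \<rho> :: "nat \<Rightarrow> nat" and n assume "strict_mono \<rho>" "convergent (\<lambda>i. y (\<tau> i) n)"
      then show "convergent (\<lambda>i. y ((\<tau> \<circ> \<rho>) i) n)"
        using convergent_subseq_convergent[of "\<lambda>i. y (\<tau> i) n" \<rho>] by (simp add: o_def)
    qed
    then have "convergent (\<lambda>i. y (diagseq (i + Suc k)) k)"
      by (simp add: o_def add.commute)
    then show ?thesis
      by (subst (asm) convergent_ignore_initial_segment)
  qed
  then have "\<forall>k. \<exists>l. (\<lambda>i. y (diagseq i) k) \<longlonglongrightarrow> l"
    by (simp add: convergent_def)
  then show ?thesis
    using subseq_diagseq by (metis)
qed

text \<open>If the sequences had no uniformly small tails, gliding humps would give
  selections of \<open>p\<close> of them with pointwise maximum of size proportional to \<open>p\<close>.\<close>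

lemma uniformly_small_tails:
  fixes y :: "nat \<Rightarrow> nat \<Rightarrow> real"
  assumes y0: "\<And>i k. 0 \<le> y i k" and r: "0 < r" "r < 1"
    and sel: "\<And>A n s. finite A \<Longrightarrow> (\<And>k. s k \<in> A) \<Longrightarrow> (\<Sum>k<n. y (s k) k) \<le> C * real (card A) powr r"
    and "0 < \<epsilon>"
  shows "\<exists>m. \<forall>i n. (\<Sum>k=m..<n. y i k) \<le> \<epsilon>"
proof (rule ccontr)
  assume "\<not> ?thesis"
  then have ex: "\<exists>i n. \<epsilon> < (\<Sum>k=m..<n. y i k)" for m
    by (meson not_le)
  have "\<exists>A n s. finite A \<and> card A \<le> p + 1 \<and> (\<forall>k. s k \<in> A) \<and> real p * \<epsilon> \<le> (\<Sum>k<n. y (s k) k)" for p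
  proof (induction p)
    case 0
    show ?case by (intro exI[of _ "{0}"] exI[of _ 0] exI[of _ "\<lambda>_. 0"]) auto
  next
    case (Suc p)
    then obtain A n s where A: "finite A" "card A \<le> p + 1" "\<And>k. s k \<in> A"
      and le: "real p * \<epsilon> \<le> (\<Sum>k<n. y (s k) k)" by blast
    obtain i n' where i: "\<epsilon> < (\<Sum>k=n..<n'. y i k)" using ex by blast
    then have n: "n < n'" using \<open>0 < \<epsilon>\<close> by (cases "n < n'") auto
    define s' where "s' k = (if k < n then s k else i)" for k
    have "(\<Sum>k<n'. y (s' k) k) = (\<Sum>k<n. y (s' k) k) + (\<Sum>k=n..<n'. y (s' k) k)"
      using n by (simp add: sum.atLeastLessThan_concat lessThan_atLeast0)
    also have "\<dots> = (\<Sum>k<n. y (s k) k) + (\<Sum>k=n..<n'. y i k)"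
      by (simp add: s'_def)
    finally have "real (Suc p) * \<epsilon> \<le> (\<Sum>k<n'. y (s' k) k)"
      using i le by (simp add: algebra_simps)
    moreover have "card (insert i A) \<le> Suc p + 1"
      using A by (simp add: card_insert_if)
    moreover have "s' k \<in> insert i A" for k
      using A by (simp add: s'_def)
    ultimately show ?case
      using A(1) by (intro exI[of _ "insert i A"] exI[of _ n'] exI[of _ s']) simp
  qed
  note selections_exist = this
  have "real p * \<epsilon> \<le> \<bar>C\<bar> * real (p + 1) powr r" for p
  proof -
    obtain A n s where A: "finite A" "card A \<le> p + 1" "\<And>k. s k \<in> A"
      and le: "real p * \<epsilon> \<le> (\<Sum>k<n. y (s k) k)"
      using selections_exist[of p] by blast
    have "real p * \<epsilon> \<le> C * real (card A) powr r"
      by (rule order_trans[OF le sel[OF A(1) A(3)]])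
    also have "\<dots> \<le> \<bar>C\<bar> * real (card A) powr r"
      by (intro mult_right_mono) auto
    also have "\<dots> \<le> \<bar>C\<bar> * real (p + 1) powr r"
      using A(2) r by (intro mult_left_mono powr_mono2) auto
    finally show ?thesis .
  qed
  then have "(real m - 1) * \<epsilon> \<le> \<bar>C\<bar> * real m powr r" for m
    using \<open>0 < \<epsilon>\<close> by (cases m) (auto simp: algebra_simps)
  then have "\<epsilon> * real m \<le> \<epsilon> + \<bar>C\<bar> * real m powr r" for m
    by (simp add: algebra_simps)
  then show False
    using powr_sublinear[OF \<open>0 < \<epsilon>\<close> r(2), of \<epsilon> "\<bar>C\<bar>"] by (meson not_le)
qed

text \<open>Uniformly small tails turn coordinatewise convergence into convergence in
  \<open>l_1\<close>. Along a subsequence with errors at most \<open>2^-j\<close>, the limit plus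
  the sum of all errors is a summable common bound.\<close>

lemma dominated_subsequence:
  fixes y :: "nat \<Rightarrow> nat \<Rightarrow> real"
  assumes y0: "\<And>i k. 0 \<le> y i k" and yB: "\<And>i k. y i k \<le> B k" and r: "0 < r" "r < 1"
    and sel: "\<And>A n s. finite A \<Longrightarrow> (\<And>k. s k \<in> A) \<Longrightarrow> (\<Sum>k<n. y (s k) k) \<le> C * real (card A) powr r"
  shows "\<exists>(\<sigma> :: nat \<Rightarrow> nat) Y. inj \<sigma> \<and> summable Y \<and> (\<forall>i k. y (\<sigma> i) k \<le> Y k)"
proof -
  have tails: "\<exists>m. \<forall>i n. (\<Sum>k=m..<n. y i k) \<le> \<epsilon>" if "0 < \<epsilon>" for \<epsilon>
    using y0 r sel that by (rule uniformly_small_tails)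
  obtain \<tau> z where \<tau>: "strict_mono \<tau>" and z: "\<And>k. (\<lambda>i. y (\<tau> i) k) \<longlonglongrightarrow> z k"
    using coordinatewise_convergent_subsequence[of y B] y0 yB by (auto simp: abs_of_nonneg)
  have z0: "0 \<le> z k" for k
    using z y0 by (intro LIMSEQ_le_const[OF z]) auto
  have ztail: "(\<Sum>k=m..<n. z k) \<le> \<epsilon>" if "\<forall>i n. (\<Sum>k=m..<n. y i k) \<le> \<epsilon>" for m n \<epsilon>
    using that z by (intro LIMSEQ_le_const2[OF tendsto_sum[OF z]]) auto
  have "summable z"
  proof -
    obtain m where m: "\<forall>i n. (\<Sum>k=m..<n. y i k) \<le> 1" using tails[of 1] by auto
    show ?thesis
    proof (rule summableI_nonneg_bounded[OF z0])
      fix n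
      have "(\<Sum>k<n. z k) \<le> (\<Sum>k\<in>{..<m} \<union> {m..<n}. z k)"
        using z0 by (intro sum_mono2) auto
      also have "\<dots> = (\<Sum>k<m. z k) + (\<Sum>k=m..<n. z k)"
        by (intro sum.union_disjoint) auto
      finally show "(\<Sum>k<n. z k) \<le> (\<Sum>k<m. z k) + 1"
        using ztail[OF m, of n] by linarith
    qed
  qed
  have "\<exists>i0. \<forall>i\<ge>i0. \<forall>n. (\<Sum>k<n. \<bar>y (\<tau> i) k - z k\<bar>) \<le> (1 / 2) ^ j" for j
  proof -
    \<comment> \<open>One third each for the first \<open>m\<close> coordinates, the tail of
      \<open>y\<close> and the tail of the limit.\<close>
    define \<epsilon> :: real where "\<epsilon> = (1 / 2) ^ j / 3"
    have "0 < \<epsilon>" by (simp add: \<epsilon>_def)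
    then obtain m where m: "\<forall>i n. (\<Sum>k=m..<n. y i k) \<le> \<epsilon>" using tails[of \<epsilon>] by auto
    have "(\<lambda>i. \<Sum>k<m. \<bar>y (\<tau> i) k - z k\<bar>) \<longlonglongrightarrow> (\<Sum>k<m. \<bar>z k - z k\<bar>)"
      by (intro tendsto_intros z)
    then have "\<forall>\<^sub>F i in sequentially. (\<Sum>k<m. \<bar>y (\<tau> i) k - z k\<bar>) < \<epsilon>"
      using \<open>0 < \<epsilon>\<close> by (auto dest: order_tendstoD)
    then obtain i0 where i0: "\<And>i. i \<ge> i0 \<Longrightarrow> (\<Sum>k<m. \<bar>y (\<tau> i) k - z k\<bar>) < \<epsilon>"
      by (auto simp: eventually_sequentially)
    have "(\<Sum>k<n. \<bar>y (\<tau> i) k - z k\<bar>) \<le> (1 / 2) ^ j" if "i \<ge> i0" for i n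
    proof -
      have "(\<Sum>k<n. \<bar>y (\<tau> i) k - z k\<bar>) \<le> (\<Sum>k\<in>{..<m} \<union> {m..<n}. \<bar>y (\<tau> i) k - z k\<bar>)"
        by (intro sum_mono2) auto
      also have "\<dots> = (\<Sum>k<m. \<bar>y (\<tau> i) k - z k\<bar>) + (\<Sum>k=m..<n. \<bar>y (\<tau> i) k - z k\<bar>)"
        by (intro sum.union_disjoint) auto
      also have "(\<Sum>k=m..<n. \<bar>y (\<tau> i) k - z k\<bar>) \<le> (\<Sum>k=m..<n. y (\<tau> i) k + z k)"
        using y0 z0 by (intro sum_mono) (smt (verit))
      also have "\<dots> = (\<Sum>k=m..<n. y (\<tau> i) k) + (\<Sum>k=m..<n. z k)"
        by (rule sum.distrib)
      finally have "(\<Sum>k<n. \<bar>y (\<tau> i) k - z k\<bar>) \<le> \<epsilon> + (\<epsilon> + \<epsilon>)"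
        using i0[OF that] m[rule_format, where i = "\<tau> i" and n = n] ztail[OF m, of n] by linarith
      then show ?thesis by (simp add: \<epsilon>_def)
    qed
    then show ?thesis by blast
  qed
  then obtain i0 where i0: "\<And>i j n. i \<ge> i0 j \<Longrightarrow> (\<Sum>k<n. \<bar>y (\<tau> i) k - z k\<bar>) \<le> (1 / 2) ^ j"
    by metis
  \<comment> \<open>Adding \<open>j\<close> makes \<open>\<rho>\<close> strictly increasing, and the
    sum makes it at least \<open>i0 j\<close>.\<close>
  define \<rho> where "\<rho> j = j + (\<Sum>l\<le>j. i0 l)" for j
  have \<rho>: "strict_mono \<rho>"
    by (rule strict_mono_Suc_iff[THEN iffD2]) (simp add: \<rho>_def)
  have \<rho>i0: "i0 j \<le> \<rho> j" for j
    by (simp add: \<rho>_def trans_le_add2 member_le_sum)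
  define u where "u j k = \<bar>y (\<tau> (\<rho> j)) k - z k\<bar>" for j k
  have usum: "(\<Sum>k<n. u j k) \<le> (1 / 2) ^ j" for j n
    unfolding u_def by (intro i0 \<rho>i0)
  have u0: "0 \<le> u j k" for j k by (simp add: u_def)
  have "u j k \<le> (1 / 2) ^ j" for j k
    by (rule order_trans[OF member_le_sum usum[where n = "Suc k"]]) (auto intro: u0)
  then have us: "summable (\<lambda>j. u j k)" for k
    using u0 by (intro summable_comparison_test[OF _ summable_geometric[of "1 / 2 :: real"]]) auto
  define Y where "Y k = z k + (\<Sum>j. u j k)" for k
  have "y (\<tau> (\<rho> j)) k \<le> Y k" for j k
  proof -
    have "u j k \<le> (\<Sum>j. u j k)"
      using sum_le_suminf[OF us, of "{j}"] u0 by simp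
    then show ?thesis by (simp add: Y_def u_def)
  qed
  moreover have "summable (\<lambda>k. \<Sum>j. u j k)"
  proof (rule summableI_nonneg_bounded)
    show "0 \<le> (\<Sum>j. u j k)" for k by (intro suminf_nonneg us u0)
    fix n
    have "(\<Sum>k<n. \<Sum>j. u j k) = (\<Sum>j. \<Sum>k<n. u j k)"
      by (intro suminf_sum[symmetric] us)
    also have "\<dots> \<le> (\<Sum>j. (1 / 2) ^ j)"
      by (intro suminf_le usum summable_sum us) simp
    finally show "(\<Sum>k<n. \<Sum>j. u j k) \<le> (\<Sum>j. (1 / 2) ^ j)" .
  qed
  then have "summable Y"
    unfolding Y_def by (intro summable_add \<open>summable z\<close>)
  moreover have "inj (\<tau> \<circ> \<rho>)"
    using \<tau> \<rho> by (intro inj_compose strict_mono_imp_inj_on)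
  ultimately show ?thesis
    by (intro exI[of _ "\<tau> \<circ> \<rho>"] exI[of _ Y]) simp
qed

section \<open>Square functions of flat sums and a common majorant\<close>

definition square_fun :: "(nat \<Rightarrow> 'b \<Rightarrow> 'a::real_normed_vector) \<Rightarrow> nat set \<Rightarrow> 'b \<Rightarrow> real" where
  "square_fun f A t = sqrt (\<Sum>i\<in>A. norm (f i t) ^ 2)"

lemma tail_mono:
  assumes "finite_measure M" "g \<in> borel_measurable M" "\<And>t. t \<in> space M \<Longrightarrow> norm (f t) \<le> norm (g t)"
  shows "tail M f l \<le> tail M g l"
proof -
  interpret finite_measure M by fact
  show ?thesis
    unfolding tail_def using assms(2,3) by (intro finite_measure_mono) (auto intro: less_le_trans)
qed

text \<open>
  An average of powers is in general smaller than the power of the average; the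
  minimum with \<open>d\<close> is what makes this direction possible.
\<close>

lemma tail_powr_le_avg:
  assumes d: "0 \<le> d" and e: "\<And>\<xi>. \<xi> \<in> S \<Longrightarrow> 0 \<le> e \<xi>" and r: "0 < r" "r < 1"
    and le: "d \<le> b * avg S (\<lambda>\<xi>. min d (e \<xi>))" and "0 \<le> b"
  shows "d powr r \<le> b * avg S (\<lambda>\<xi>. e \<xi> powr r)"
proof (cases "d = 0")
  case True
  then show ?thesis using assms by (simp add: avg_nonneg)
next
  case False
  then have d0: "0 < d" using d by simp
  have "min d (e \<xi>) \<le> d powr (1 - r) * e \<xi> powr r" if "\<xi> \<in> S" for \<xi>
  proof -
    have m: "0 \<le> min d (e \<xi>)" using d0 e[OF that] by simp
    have "min d (e \<xi>) = min d (e \<xi>) powr (1 - r) * min d (e \<xi>) powr r"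
      using m by (simp add: powr_add[symmetric])
    also have "\<dots> \<le> d powr (1 - r) * e \<xi> powr r"
      using m r by (intro mult_mono powr_mono2) auto
    finally show ?thesis .
  qed
  then have "b * avg S (\<lambda>\<xi>. min d (e \<xi>)) \<le> b * avg S (\<lambda>\<xi>. d powr (1 - r) * e \<xi> powr r)"
    using \<open>0 \<le> b\<close> by (intro mult_left_mono avg_mono)
  then have "d \<le> d powr (1 - r) * (b * avg S (\<lambda>\<xi>. e \<xi> powr r))"
    using le unfolding avg_cmult by (simp add: mult_ac)
  then have "d powr (1 - r) * d powr r \<le> d powr (1 - r) * (b * avg S (\<lambda>\<xi>. e \<xi> powr r))"
    using d0 by (simp add: powr_add[symmetric])
  then show ?thesis using d0 by simp
qed

context
  fixes M :: "'b measure" and f :: "nat \<Rightarrow> 'b \<Rightarrow> 'a::euclidean_space" and r B :: real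
  assumes M1: "finite_measure M" "measure M (space M) = 1"
    and r: "0 < r" "r < 1"
    and meas: "\<And>i. f i \<in> borel_measurable M"
    and upper: "\<And>A e w n. finite A \<Longrightarrow> (\<And>i. i \<in> A \<Longrightarrow> e i \<in> {-1, 1}) \<Longrightarrow> 0 < w \<Longrightarrow>
       (\<Sum>k<n. (4 ^ k * tail M (\<lambda>t. \<Sum>i\<in>A. (w * e i) *\<^sub>R f i t) (2 ^ k / 2)) powr r)
           \<le> B * (w\<^sup>2 * card A) powr r"
begin

interpretation finite_measure M by (fact M1)

lemma borel_measurable_square_fun: "square_fun f A \<in> borel_measurable M"
  unfolding square_fun_def[abs_def] using meas by measurable

text \<open>Wherever the square function exceeds \<open>2^k\<close>, \<open>paley_zygmund\<close>
  makes at least one eighth of the signed sums exceed \<open>2^k / 2\<close>; hence the halved level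
  in the assumption \<open>upper\<close>. The measure of the joint event is at most either of the
  two tails, which is the minimum required by \<open>tail_powr_le_avg\<close>; that lemma keeps the
  8 outside the power.\<close>

lemma square_fun_tail:
  assumes A: "finite A" and w: "0 < w"
  shows "(\<Sum>k<n. (4 ^ k * tail M (\<lambda>t. w * square_fun f A t) (2 ^ k)) powr r)
      \<le> 8 * B * (w\<^sup>2 * card A) powr r"
proof -
  define \<Omega> where "\<Omega> = selections A (\<lambda>_. {()})"
  define X where "X (\<xi> :: nat \<Rightarrow> unit \<times> real) t = rsum (\<lambda>i _. w *\<^sub>R f i t) A \<xi>" for \<xi> t
  have fin: "finite \<Omega>" "\<Omega> \<noteq> {}"
    unfolding \<Omega>_def using A by (auto intro!: finite_PiE simp: PiE_eq_empty_iff)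
  have Xm: "X \<xi> \<in> borel_measurable M" if "\<xi> \<in> \<Omega>" for \<xi>
    unfolding X_def[abs_def] using that meas unfolding \<Omega>_def
    by (intro borel_measurable_rsum[OF M1, where f = "\<lambda>i _ t. w *\<^sub>R f i t" and S = "\<lambda>_. {()}"]) auto
  let ?g = "\<lambda>t. w * square_fun f A t"
  have gm: "?g \<in> borel_measurable M"
    by (intro borel_measurable_times borel_measurable_const borel_measurable_square_fun)
  have g2: "?g t ^ 2 = (\<Sum>i\<in>A. norm (w *\<^sub>R f i t) ^ 2)" for t
    by (simp add: square_fun_def power_mult_distrib sum_nonneg sum_distrib_left)
  have g0: "0 \<le> ?g t" for t
    using w by (simp add: square_fun_def sum_nonneg)
  have pt: "of_bool (2 ^ k < norm (?g t)) \<le>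
      8 * avg \<Omega> (\<lambda>\<xi>. of_bool (2 ^ k < norm (?g t) \<and> 2 ^ k / 2 < norm (X \<xi> t)))" for k t
  proof (cases "2 ^ k < norm (?g t)")
    case True
    then have gt: "2 ^ k < ?g t" using g0[of t] by (simp only: real_norm_def abs_of_nonneg)
    then have gpos: "0 < ?g t" using less_trans zero_less_power by (metis zero_less_numeral)
    have "1 / 8 \<le> avg \<Omega> (\<lambda>\<xi>. of_bool (?g t ^ 2 / 4 < norm (X \<xi> t) ^ 2))"
      unfolding \<Omega>_def X_def using A gpos by (intro paley_zygmund g2) auto
    also have "\<dots> \<le> avg \<Omega> (\<lambda>\<xi>. of_bool (2 ^ k < norm (?g t) \<and> 2 ^ k / 2 < norm (X \<xi> t)))"
    proof (rule avg_mono)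
      fix \<xi>
      have "2 ^ k / 2 < norm (X \<xi> t)" if "?g t ^ 2 / 4 < norm (X \<xi> t) ^ 2"
      proof -
        have "(?g t / 2) ^ 2 < norm (X \<xi> t) ^ 2"
          using that by (simp add: power_divide)
        then have "?g t / 2 < norm (X \<xi> t)"
          by (rule power_less_imp_less_base) simp
        then show ?thesis using gt by linarith
      qed
      then show "of_bool (?g t ^ 2 / 4 < norm (X \<xi> t) ^ 2) \<le>
          (of_bool (2 ^ k < norm (?g t) \<and> 2 ^ k / 2 < norm (X \<xi> t)) :: real)"
        using True by simp
    qed
    finally show ?thesis using True by simp
  qed (simp add: avg_nonneg)
  have le: "tail M ?g (2 ^ k) \<le> 8 * avg \<Omega> (\<lambda>\<xi>. min (tail M ?g (2 ^ k)) (tail M (X \<xi>) (2 ^ k /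
      2)))" for k
  proof -
    have i: "integrable M (\<lambda>t. of_bool (2 ^ k < norm (?g t) \<and> 2 ^ k / 2 < norm (X \<xi> t)) :: real)"
        if "\<xi> \<in> \<Omega>" for \<xi>
    proof (rule integrable_const_bound[where B = 1])
      show "(\<lambda>t. of_bool (2 ^ k < norm (?g t) \<and> 2 ^ k / 2 < norm (X \<xi> t)) :: real) \<in>
          borel_measurable M"
        using gm Xm[OF that] by measurable
    qed auto
    have "tail M ?g (2 ^ k) = (\<integral>t. of_bool (2 ^ k < norm (?g t)) \<partial>M)"
      by (rule tail_eq_integral[OF M1 gm])
    also have "\<dots> \<le> (\<integral>t. 8 * avg \<Omega> (\<lambda>\<xi>. of_bool (2 ^ k < norm (?g t) \<and> 2 ^ k / 2 < norm (X \<xi> t)))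
        \<partial>M)"
      by (intro integral_mono integrable_tail[OF M1] gm integrable_mult_right integral_avg[OF M1]
          i pt)
    also have "\<dots> = 8 * avg \<Omega> (\<lambda>\<xi>. \<integral>t. of_bool (2 ^ k < norm (?g t) \<and> 2 ^ k / 2 < norm (X \<xi> t)) \<partial>M)"
      by (simp only: integral_mult_right_zero integral_avg[OF M1 i])
    also have "\<dots> \<le> 8 * avg \<Omega> (\<lambda>\<xi>. min (tail M ?g (2 ^ k)) (tail M (X \<xi>) (2 ^ k / 2)))"
    proof (intro mult_left_mono avg_mono min.boundedI)
      fix \<xi> assume \<xi>: "\<xi> \<in> \<Omega>"
      show "(\<integral>t. of_bool (2 ^ k < norm (?g t) \<and> 2 ^ k / 2 < norm (X \<xi> t)) \<partial>M) \<le> tail M ?g (2 ^ k)"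
        unfolding tail_eq_integral[OF M1 gm]
        by (intro integral_mono i \<xi> integrable_tail[OF M1] gm) auto
      show "(\<integral>t. of_bool (2 ^ k < norm (?g t) \<and> 2 ^ k / 2 < norm (X \<xi> t)) \<partial>M)
          \<le> tail M (X \<xi>) (2 ^ k / 2)"
        unfolding tail_eq_integral[OF M1 Xm[OF \<xi>]]
        by (intro integral_mono i \<xi> integrable_tail[OF M1] Xm) auto
    qed auto
    finally show ?thesis .
  qed
  have "(\<Sum>k<n. (4 ^ k * tail M ?g (2 ^ k)) powr r) \<le>
      (\<Sum>k<n. 8 * avg \<Omega> (\<lambda>\<xi>. (4 ^ k * tail M (X \<xi>) (2 ^ k / 2)) powr r))"
  proof (rule sum_mono)
    fix k
    have "(4 ^ k * tail M ?g (2 ^ k)) powr r = (4 ^ k) powr r * tail M ?g (2 ^ k) powr r"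
      by (simp add: powr_mult tail_nonneg)
    also have "\<dots> \<le> (4 ^ k) powr r * (8 * avg \<Omega> (\<lambda>\<xi>. tail M (X \<xi>) (2 ^ k / 2) powr r))"
      using r by (intro mult_left_mono tail_powr_le_avg le) (auto simp: tail_nonneg)
    also have "\<dots> = 8 * avg \<Omega> (\<lambda>\<xi>. (4 ^ k * tail M (X \<xi>) (2 ^ k / 2)) powr r)"
      by (simp add: powr_mult tail_nonneg avg_cmult)
    finally show "(4 ^ k * tail M ?g (2 ^ k)) powr r
        \<le> 8 * avg \<Omega> (\<lambda>\<xi>. (4 ^ k * tail M (X \<xi>) (2 ^ k / 2)) powr r)" .
  qed
  also have "\<dots> = 8 * avg \<Omega> (\<lambda>\<xi>. \<Sum>k<n. (4 ^ k * tail M (X \<xi>) (2 ^ k / 2)) powr r)"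
    by (simp add: avg_sum sum_distrib_left)
  also have "\<dots> \<le> 8 * avg \<Omega> (\<lambda>\<xi>. B * (w\<^sup>2 * card A) powr r)"
  proof (intro mult_left_mono avg_mono)
    fix \<xi> assume \<xi>: "\<xi> \<in> \<Omega>"
    have X: "X \<xi> = (\<lambda>t. \<Sum>i\<in>A. (w * snd (\<xi> i)) *\<^sub>R f i t)"
      by (simp add: X_def[abs_def] rsum_def mult.commute)
    show "(\<Sum>k<n. (4 ^ k * tail M (X \<xi>) (2 ^ k / 2)) powr r) \<le> B * (w\<^sup>2 * card A) powr r"
      unfolding X
    proof (rule upper[OF A _ w])
      fix i assume "i \<in> A"
      then have "\<xi> i \<in> {()} \<times> {-1, 1}" using \<xi> unfolding \<Omega>_def by (rule PiE_mem[rotated])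
      then show "snd (\<xi> i) \<in> {-1, 1}" by auto
    qed
  qed auto
  also have "\<dots> = 8 * B * (w\<^sup>2 * card A) powr r"
    by (simp add: avg_const fin)
  finally show ?thesis .
qed

text \<open>A different member of \<open>A\<close> may be used at each level because the square
  function of \<open>A\<close> majorizes every one of them; its size is of order
  \<open>(card A)^r\<close>. Total mass 1 supplies the coordinatewise bound
  \<open>(4^k)^r\<close>.\<close>

lemma dominating_subsequence:
  "\<exists>(\<sigma> :: nat \<Rightarrow> nat) Y. inj \<sigma> \<and> summable Y \<and> (\<forall>i k. (4 ^ k * tail M (f (\<sigma> i)) (2 ^ k)) powr r
      \<le> Y k)"
proof (rule dominated_subsequence[OF _ _ r])
  show "0 \<le> (4 ^ k * tail M (f i) (2 ^ k)) powr r" for i k by simp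
  show "(4 ^ k * tail M (f i) (2 ^ k)) powr r \<le> (4 ^ k) powr r" for i k
    using tail_le_1[OF M1, of "f i" "2 ^ k"] tail_nonneg[of M "f i" "2 ^ k"] r
    by (intro powr_mono2) (auto simp: mult_left_le)
  fix A n and s :: "nat \<Rightarrow> nat" assume A: "finite A" and s: "\<And>k. s k \<in> A"
  have "(\<Sum>k<n. (4 ^ k * tail M (f (s k)) (2 ^ k)) powr r) \<le>
      (\<Sum>k<n. (4 ^ k * tail M (\<lambda>t. 1 * square_fun f A t) (2 ^ k)) powr r)"
  proof (intro sum_mono powr_mono2 mult_left_mono tail_mono M1)
    show "(\<lambda>t. 1 * square_fun f A t) \<in> borel_measurable M"
      using borel_measurable_square_fun[of A] by simp
    fix k t
    have "norm (f (s k) t) ^ 2 \<le> (\<Sum>i\<in>A. norm (f i t) ^ 2)"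
      using A s by (intro member_le_sum) auto
    then have "norm (f (s k) t) \<le> square_fun f A t"
      unfolding square_fun_def by (rule real_le_rsqrt)
    then show "norm (f (s k) t) \<le> norm (1 * square_fun f A t)" by simp
  qed (use r in \<open>auto simp: tail_nonneg\<close>)
  also have "\<dots> \<le> 8 * B * (1\<^sup>2 * real (card A)) powr r"
    by (rule square_fun_tail[OF A zero_less_one])
  finally show "(\<Sum>k<n. (4 ^ k * tail M (f (s k)) (2 ^ k)) powr r) \<le> 8 * B * real (card A) powr r"
    by simp
qed

end

subsection \<open>Block sums\<close>

text \<open>The contradiction in abstract form: flat sums are bounded above, while every choice of
  distinct functions gives a large block sum. In \<open>lower\<close> the summand 1 absorbs the
  levels below 1, and the number of levels needed may depend on the choice.\<close>

lemma no_spreading_sequence: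
  fixes M :: "'b measure" and f :: "nat \<Rightarrow> 'b \<Rightarrow> 'a::euclidean_space" and r B c :: real
  assumes M1: "finite_measure M" "measure M (space M) = 1"
    and r: "0 < r" "r < 1"
    and meas: "\<And>i. f i \<in> borel_measurable M"
    and upper: "\<And>A e w n. finite A \<Longrightarrow> (\<And>i. i \<in> A \<Longrightarrow> e i \<in> {-1, 1}) \<Longrightarrow> 0 < w \<Longrightarrow>
       (\<Sum>k<n. (4 ^ k * tail M (\<lambda>t. \<Sum>i\<in>A. (w * e i) *\<^sub>R f i t) (2 ^ k / 2)) powr r)
           \<le> B * (w\<^sup>2 * card A) powr r"
    and c: "0 < c"
    and lower: "\<And>m k0 (s :: nat \<times> nat \<Rightarrow> nat) e. inj_on s (Sigma {..<m} (\<lambda>j. {..<4 ^ (k0 + j)})) \<Longrightarrow>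
       (\<And>x. x \<in> Sigma {..<m} (\<lambda>j. {..<4 ^ (k0 + j)}) \<Longrightarrow> e x \<in> {-1, 1}) \<Longrightarrow>
       \<forall>\<^sub>F n in sequentially. c * real m \<le> 1 + (\<Sum>k<n. (4 ^ k * tail M
         (\<lambda>t. \<Sum>x\<in>Sigma {..<m} (\<lambda>j. {..<4 ^ (k0 + j)}). (e x / 2 ^ (k0
             + fst x)) *\<^sub>R f (s x) t) (2 ^ k)) powr r)"
  shows False
proof -
  interpret finite_measure M by (fact M1)
  obtain \<sigma> :: "nat \<Rightarrow> nat" and Y where \<sigma>: "inj \<sigma>" and Y: "summable Y"
    and dom: "\<And>i k. (4 ^ k * tail M (f (\<sigma> i)) (2 ^ k)) powr r \<le> Y k"
    using dominating_subsequence[OF M1 r meas upper] by blast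
  have Y0: "0 \<le> Y k" for k
    by (rule order_trans[OF powr_ge_zero dom])
  define a where "a l = Y l powr (1 / r)" for l
  have a0: "0 \<le> a l" for l by (simp add: a_def)
  have ar: "a l powr r \<le> Y l" for l
    using r Y0 by (simp add: a_def powr_powr)
  have adom: "4 ^ l * tail M (f (\<sigma> i)) (2 ^ l) \<le> a l" for i l
  proof -
    have "4 ^ l * tail M (f (\<sigma> i)) (2 ^ l)
        = ((4 ^ l * tail M (f (\<sigma> i)) (2 ^ l)) powr r) powr (1 / r)"
      using r by (simp add: powr_powr tail_nonneg)
    also have "\<dots> \<le> a l"
      unfolding a_def using r by (intro powr_mono2 dom) auto
    finally show ?thesis .
  qed
  define \<theta> where "\<theta> = (1 / 4 :: real) powr r"
  have \<theta>: "0 \<le> \<theta>" "\<theta> < 1"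
    using r powr_less_mono2[of r "1 / 4 :: real" 1] by (auto simp: \<theta>_def)
  have "summable (hardy_sum \<theta> Y)"
    using \<theta> Y0 Y by (intro hardy_sum_summable)
  \<comment> \<open>\<open>k0\<close> is fixed before the number of blocks, so that the dominating
    tails cost at most \<open>c / 2\<close> per block, half of what \<open>lower\<close>
    provides.\<close>
  then have "\<exists>k0. \<forall>m\<ge>k0. \<forall>n. norm (\<Sum>k=m..<n. hardy_sum \<theta> Y k) < c / 2"
    unfolding summable_Cauchy using c by (elim allE[of _ "c / 2"]) simp
  then obtain k0 where k0': "\<And>m n. m \<ge> k0 \<Longrightarrow> norm (\<Sum>k=m..<n. hardy_sum \<theta> Y k) < c / 2"
    by blast
  have k0: "(\<Sum>k=m..<n. hardy_sum \<theta> Y k) < c / 2" if "m \<ge> k0" for m n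
    using k0'[OF that, of n] by (simp only: real_norm_def abs_less_iff)
  \<comment> \<open>408 is 3 * 17 * 8: from the tail estimate, from \<open>hardy_sum_sum_le\<close>
    and from \<open>square_fun_tail\<close>.\<close>
  have main: "c * real m \<le> (1 + 3 / (1 - \<theta>)) + real m * (c / 2)
      + (408 * B / (1 - \<theta>)) * real m powr r" for m
  proof -
    define I where "I = Sigma {..<m} (\<lambda>j. {..<4 ^ (k0 + j) :: nat})"
    define p where "p x = k0 + fst x" for x :: "nat \<times> nat"
    \<comment> \<open>The pool size equalizes the blocks:
      \<open>4^(m-j) * 4^(k0+j) = 4^(k0+m)\<close> does not depend on \<open>j\<close>, so every
      candidate enters \<open>V\<close> with the same weight \<open>w^2\<close>.\<close>
    define S where "S x = {..<4 ^ (m - fst x) :: nat}" for x :: "nat \<times> nat"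
    \<comment> \<open>Encoding position and candidate together makes the pools disjoint, so every
      selection uses distinct functions, as \<open>lower\<close> demands.\<close>
    define \<iota> where "\<iota> x l = \<sigma> (to_nat (x, l))" for x :: "nat \<times> nat" and l :: nat
    define A where "A = (\<lambda>(x, l). \<iota> x l) ` Sigma I S"
    define w where "w = (1 / 2 ^ (k0 + m) :: real)"
    define \<Omega> where "\<Omega> = selections I S"
    define X where "X \<xi> t = rsum (\<lambda>x l. (1 / 2 ^ p x) *\<^sub>R f (\<iota> x l) t) I \<xi>" for \<xi> t
    have I: "finite I" "\<And>x. x \<in> I \<Longrightarrow> finite (S x)" "\<And>x. x \<in> I \<Longrightarrow> S x \<noteq> {}"
      by (auto simp: I_def S_def lessThan_empty_iff)
    have fin: "finite \<Omega>" "\<Omega> \<noteq> {}"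
      unfolding \<Omega>_def using I by (auto intro!: finite_PiE simp: PiE_eq_empty_iff)
    have inj: "\<iota> x l = \<iota> x' l' \<longleftrightarrow> x = x' \<and> l = l'" for x l x' l'
      unfolding \<iota>_def using inj_eq[OF \<sigma>] by simp
    have injA: "inj_on (\<lambda>(x, l). \<iota> x l) (Sigma I S)"
      by (auto simp: inj_on_def inj)
    have pw: "(4::real) ^ (m - fst x) * 4 ^ p x = 4 ^ (k0 + m)" if "x \<in> I" for x
      using that unfolding I_def p_def by (auto simp flip: power_add)
    have "card A = (\<Sum>x\<in>I. 4 ^ (m - fst x))"
      unfolding A_def using I by (simp add: card_image[OF injA] S_def)
    also have "\<dots> = (\<Sum>j<m. \<Sum>i<(4::nat) ^ (k0 + j). 4 ^ (m - j))"
      unfolding I_def by (subst sum.Sigma) (auto simp: case_prod_unfold)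
    also have "\<dots> = (\<Sum>j<m. 4 ^ (k0 + m))"
      by (intro sum.cong) (auto simp add: ac_simps simp flip: power_add)
    finally have cardA: "card A = m * 4 ^ (k0 + m)" by simp
    have w2: "w\<^sup>2 = 1 / 4 ^ (k0 + m)"
      by (simp add: w_def power_divide power2_eq_square flip: power_mult_distrib)
    then have wA: "w\<^sup>2 * real (card A) = real m"
      by (simp add: cardA)
    define V where "V t = (\<Sum>x\<in>I. avg (S x) (\<lambda>l. norm (f (\<iota> x l) t) ^ 2) / 4 ^ p x)" for t
    have V: "sqrt (V t) = w * square_fun f A t" for t
    proof -
      have "V t = (\<Sum>x\<in>I. (\<Sum>l\<in>S x. norm (f (\<iota> x l) t) ^ 2) / 4 ^ (k0 + m))"
        unfolding V_def by (intro sum.cong refl) (simp add: avg_def S_def flip: pw)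
      also have "\<dots> = w\<^sup>2 * (\<Sum>x\<in>I. \<Sum>l\<in>S x. norm (f (\<iota> x l) t) ^ 2)"
        by (simp add: w2 sum_divide_distrib)
      also have "(\<Sum>x\<in>I. \<Sum>l\<in>S x. norm (f (\<iota> x l) t) ^ 2)
          = (\<Sum>(x, l)\<in>Sigma I S. norm (f (\<iota> x l) t) ^ 2)"
        using I by (intro sum.Sigma) auto
      also have "\<dots> = (\<Sum>i\<in>A. norm (f i t) ^ 2)"
        unfolding A_def by (subst sum.reindex[OF injA]) (simp add: case_prod_unfold)
      finally show ?thesis
        by (simp add: square_fun_def real_sqrt_mult w_def)
    qed
    define z where "z l = (4 ^ l * tail M (\<lambda>t. w * square_fun f A t) (2 ^ l)) powr r" for l
    have zsum: "(\<Sum>k<n. z k) \<le> 8 * B * real m powr r" for n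
      unfolding z_def wA[symmetric] using I
      by (intro square_fun_tail[OF M1 r meas upper]) (auto simp: w_def A_def)
    have average: "(4 ^ k * avg \<Omega> (\<lambda>\<xi>. tail M (X \<xi>) (2 ^ k))) powr r \<le>
        (\<Sum>j<m. hardy_sum \<theta> Y (k + (k0 + j))) + 3 * hardy_sum \<theta> z k" for k
    proof -
      have "4 ^ k * avg \<Omega> (\<lambda>\<xi>. tail M (X \<xi>) (2 ^ k)) \<le> (\<Sum>x\<in>I. hardy_sum (1 / 4) a (k
          + p x) / 4 ^ p x)
         + 3 * hardy_sum (1 / 4) (\<lambda>l. 4 ^ l * tail M (\<lambda>t. sqrt (V t)) (2 ^ l)) k"
        unfolding \<Omega>_def X_def
        by (rule avg_tail_le[OF M1 I meas V_def]) (simp_all add: \<iota>_def adom)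
      \<comment> \<open>The \<open>4^(k0+j)\<close> positions of block \<open>j\<close> cancel its
        denominator.\<close>
      also have "(\<Sum>x\<in>I. hardy_sum (1 / 4) a (k + p x) / 4 ^ p x) =
          (\<Sum>j<m. \<Sum>i<(4::nat) ^ (k0 + j). hardy_sum (1 / 4) a (k + (k0 + j)) / 4 ^ (k0 + j))"
        unfolding I_def p_def by (subst sum.Sigma) (auto simp: case_prod_unfold)
      also have "\<dots> = (\<Sum>j<m. hardy_sum (1 / 4) a (k + (k0 + j)))"
        by simp
      finally have "(4 ^ k * avg \<Omega> (\<lambda>\<xi>. tail M (X \<xi>) (2 ^ k))) powr r \<le>
         ((\<Sum>j<m. hardy_sum (1 / 4) a (k + (k0 + j)))
             + 3 * hardy_sum (1 / 4) (\<lambda>l. 4 ^ l * tail M (\<lambda>t. sqrt (V t)) (2 ^ l)) k) powr r"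
        using r by (intro powr_mono2 mult_nonneg_nonneg avg_nonneg tail_nonneg) auto
      also have "\<dots> \<le> (\<Sum>j<m. hardy_sum (1 / 4) a (k + (k0 + j))) powr r
         + (3 * hardy_sum (1 / 4) (\<lambda>l. 4 ^ l * tail M (\<lambda>t. sqrt (V t)) (2 ^ l)) k) powr r"
        using r by (intro powr_add_le sum_nonneg mult_nonneg_nonneg hardy_sum_nonneg a0
            tail_nonneg) auto
      also have "(\<Sum>j<m. hardy_sum (1 / 4) a (k + (k0 + j))) powr r \<le> (\<Sum>j<m. hardy_sum (1 / 4) a (k
          + (k0 + j)) powr r)"
        using r by (intro powr_sum_le hardy_sum_nonneg a0) auto
      also have "\<dots> \<le> (\<Sum>j<m. hardy_sum \<theta> Y (k + (k0 + j)))"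
        unfolding \<theta>_def using r by (intro sum_mono hardy_sum_powr_le a0 ar) auto
      also have "(3 * hardy_sum (1 / 4) (\<lambda>l. 4 ^ l * tail M (\<lambda>t. sqrt (V t)) (2 ^ l)) k) powr r =
         3 powr r * hardy_sum (1 / 4) (\<lambda>l. 4 ^ l * tail M (\<lambda>t. sqrt (V t)) (2 ^ l)) k powr r"
        by (intro powr_mult)
      also have "\<dots> \<le> 3 * hardy_sum \<theta> z k"
        unfolding \<theta>_def using r powr_mono[of r 1 3]
        by (intro mult_mono hardy_sum_powr_le) (auto simp: V z_def tail_nonneg)
      finally show ?thesis by simp
    qed
    have ev: "\<forall>\<^sub>F n in sequentially. c * real m \<le> 1 + (\<Sum>k<n. (4 ^ k * tail M (X \<xi>) (2 ^ k)) powr r)"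
      if \<xi>: "\<xi> \<in> \<Omega>" for \<xi>
    proof -
      have \<xi>x: "snd (\<xi> x) \<in> {-1, 1}" if "x \<in> I" for x
        using PiE_mem[OF \<xi>[unfolded \<Omega>_def] that] by (auto simp: mem_Times_iff)
      have "X \<xi> = (\<lambda>t. \<Sum>x\<in>I. (snd (\<xi> x) / 2 ^ (k0 + fst x)) *\<^sub>R f (\<iota> x (fst (\<xi> x))) t)"
        by (simp add: X_def[abs_def] rsum_def p_def)
      then show ?thesis
        using lower[of "\<lambda>x. \<iota> x (fst (\<xi> x))" m k0 "\<lambda>x. snd (\<xi> x)"] \<xi>x
        by (simp add: I_def[symmetric] inj_on_def inj)
    qed
    \<comment> \<open>There are finitely many selections, so one \<open>n\<close> serves all of them
      and the average can be taken.\<close>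
    have "\<forall>\<^sub>F n in sequentially. \<forall>\<xi>\<in>\<Omega>. c * real m \<le> 1
        + (\<Sum>k<n. (4 ^ k * tail M (X \<xi>) (2 ^ k)) powr r)"
      using fin ev by (simp add: eventually_ball_finite_distrib)
    then obtain n where n: "\<And>\<xi>. \<xi> \<in> \<Omega> \<Longrightarrow> c * real m \<le> 1
        + (\<Sum>k<n. (4 ^ k * tail M (X \<xi>) (2 ^ k)) powr r)"
      by (auto simp: eventually_sequentially)
    have "c * real m = avg \<Omega> (\<lambda>\<xi>. c * real m)"
      by (simp add: avg_const fin)
    also have "\<dots> \<le> avg \<Omega> (\<lambda>\<xi>. 1 + (\<Sum>k<n. (4 ^ k * tail M (X \<xi>) (2 ^ k)) powr r))"
      by (intro avg_mono n)
    also have "\<dots> = 1 + (\<Sum>k<n. avg \<Omega> (\<lambda>\<xi>. (4 ^ k * tail M (X \<xi>) (2 ^ k)) powr r))"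
      by (simp add: avg_add avg_const fin avg_sum)
    also have "\<dots> \<le> 1 + (\<Sum>k<n. (\<Sum>j<m. hardy_sum \<theta> Y (k + (k0 + j))) + 3 * hardy_sum \<theta> z k)"
    proof (intro add_left_mono sum_mono)
      fix k
      have "avg \<Omega> (\<lambda>\<xi>. (4 ^ k * tail M (X \<xi>) (2 ^ k)) powr r)
          \<le> avg \<Omega> (\<lambda>\<xi>. 4 ^ k * tail M (X \<xi>) (2 ^ k)) powr r"
        using r by (intro avg_powr_le fin) (auto simp: tail_nonneg)
      then show "avg \<Omega> (\<lambda>\<xi>. (4 ^ k * tail M (X \<xi>) (2 ^ k)) powr r) \<le>
          (\<Sum>j<m. hardy_sum \<theta> Y (k + (k0 + j))) + 3 * hardy_sum \<theta> z k"
        using average[of k] unfolding avg_cmult by linarith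
    qed
    also have "\<dots> = 1 + (\<Sum>j<m. \<Sum>k<n. hardy_sum \<theta> Y (k + (k0 + j))) + 3 * (\<Sum>k<n. hardy_sum \<theta> z k)"
      by (subst sum.swap) (simp add: sum.distrib sum_distrib_left)
    also have "(\<Sum>j<m. \<Sum>k<n. hardy_sum \<theta> Y (k + (k0 + j))) \<le> (\<Sum>j<m. c / 2)"
    proof (rule sum_mono)
      fix j
      have "(\<Sum>k<n. hardy_sum \<theta> Y (k + (k0 + j))) = (\<Sum>k=k0+j..<n+(k0+j). hardy_sum \<theta> Y k)"
        using sum.shift_bounds_nat_ivl[of "hardy_sum \<theta> Y" 0 "k0 + j" n]
            by (simp add: lessThan_atLeast0)
      then show "(\<Sum>k<n. hardy_sum \<theta> Y (k + (k0 + j))) \<le> c / 2"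
        using k0[of "k0 + j" "n + (k0 + j)"] by simp
    qed
    also have "(\<Sum>k<n. hardy_sum \<theta> z k) \<le> (1 + 17 * (8 * B * real m powr r)) / (1 - \<theta>)"
      using \<theta> zsum[of n]
      by (intro order_trans[OF hardy_sum_sum_le] divide_right_mono) (auto simp: z_def)
    finally show ?thesis
      by (simp add: add_divide_distrib distrib_left mult_ac)
  qed
  obtain m where "(1 + 3 / (1 - \<theta>)) + (408 * B / (1 - \<theta>)) * real m powr r < c / 2 * real m"
    using powr_sublinear[OF half_gt_zero[OF c] r(2)] by blast
  then show False
    using main[of m] by (simp add: mult.commute[of _ "real m"])
qed

subsection \<open>The quasi-norm in terms of distributions\<close>

definition qnorm_pow :: "real \<Rightarrow> real set \<Rightarrow> (real \<Rightarrow> 'a::real_normed_field) \<Rightarrow> ennreal" where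
  "qnorm_pow q I f = (\<integral>\<^sup>+t\<in>{0<..}. ennpowr (ennreal (t powr (1/2)) * rearrangement I f t) q *
      ennreal (1 / t) \<partial>lborel)"

lemma ennpowr_ennreal: "0 \<le> x \<Longrightarrow> ennpowr (ennreal x) a = ennreal (x powr a)"
  by (simp add: ennpowr_def)

lemma ennpowr_mono:
  assumes "x \<le> y" "0 < a"
  shows "ennpowr x a \<le> ennpowr y a"
proof (cases "y = \<infinity>")
  case False
  then have "x \<noteq> \<infinity>" using assms(1) by (auto simp: top_unique)
  then show ?thesis
    using assms False
    by (auto simp: ennpowr_def less_top intro!: ennreal_leI powr_mono2 enn2real_mono)
qed (simp add: ennpowr_def)

lemma rearrangement_le:
  assumes "0 < l" "emeasure (lebesgue_on I) {x \<in> I. l < norm (f x)} \<le> ennreal t"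
  shows "rearrangement I f t \<le> ennreal l"
  unfolding rearrangement_def using assms by (intro Inf_lower) auto

lemma rearrangement_eq_0:
  assumes "\<And>l. 0 < l \<Longrightarrow> emeasure (lebesgue_on I) {x \<in> I. l < norm (f x)} \<le> ennreal t"
  shows "rearrangement I f t = 0"
proof -
  have "rearrangement I f t \<le> 0 + ennreal e" if "0 < e" for e
    using rearrangement_le[OF that assms[OF that]] by simp
  then have "rearrangement I f t \<le> 0"
    by (rule ennreal_le_epsilon)
  then show ?thesis by simp
qed

lemma superlevel_sets:
  fixes f :: "real \<Rightarrow> 'a::{real_normed_field, euclidean_space}"
  assumes "f \<in> borel_measurable (lebesgue_on I)"
  shows "{x \<in> I. l < norm (f x)} \<in> sets (lebesgue_on I)"
proof -
  have "{x \<in> space (lebesgue_on I). l < norm (f x)} \<in> sets (lebesgue_on I)"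
    using assms by measurable
  then show ?thesis by simp
qed

lemma rearrangement_ge:
  fixes f :: "real \<Rightarrow> 'a::{real_normed_field, euclidean_space}"
  assumes "f \<in> borel_measurable (lebesgue_on I)"
    and "ennreal t < emeasure (lebesgue_on I) {x \<in> I. l < norm (f x)}"
  shows "ennreal l \<le> rearrangement I f t"
  unfolding rearrangement_def
proof (rule Inf_greatest, clarify)
  fix s :: real assume s: "0 < s" "emeasure (lebesgue_on I) {x \<in> I. s < norm (f x)} \<le> ennreal t"
  have "l \<le> s"
  proof (rule ccontr)
    assume "\<not> l \<le> s"
    then have "emeasure (lebesgue_on I) {x \<in> I. l < norm (f x)}
        \<le> emeasure (lebesgue_on I) {x \<in> I. s < norm (f x)}"
      by (intro emeasure_mono superlevel_sets assms) auto
    then show False using s assms(2) by auto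
  qed
  then show "ennreal l \<le> ennreal s" by (rule ennreal_leI)
qed

lemma integrand_const:
  assumes "0 < t" "0 \<le> l"
  shows "ennpowr (ennreal (t powr (1/2)) * ennreal l) (2 * r) * ennreal (1 / t)
      = ennreal (l powr (2 * r)) * ennreal (t powr (r - 1))"
proof -
  have "(t powr (1/2) * l) powr (2 * r) * (1 / t) = l powr (2 * r) * t powr (r - 1)"
    using assms by (simp add: powr_mult powr_powr powr_diff)
  then show ?thesis
    using assms by (simp add: ennpowr_ennreal flip: ennreal_mult)
qed

lemma integrand_le:
  assumes "0 < t" "0 \<le> l" "rearrangement I f t \<le> ennreal l" "0 < r"
  shows "ennpowr (ennreal (t powr (1/2)) * rearrangement I f t) (2 * r) * ennreal (1 / t)
    \<le> ennreal (l powr (2 * r)) * ennreal (t powr (r - 1))"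
  unfolding integrand_const[OF assms(1,2), symmetric]
  using assms by (intro mult_right_mono ennpowr_mono mult_left_mono) auto

lemma integrand_ge:
  assumes "0 < t" "0 \<le> l" "ennreal l \<le> rearrangement I f t" "0 < r"
  shows "ennreal (l powr (2 * r)) * ennreal (t powr (r - 1))
    \<le> ennpowr (ennreal (t powr (1/2)) * rearrangement I f t) (2 * r) * ennreal (1 / t)"
  unfolding integrand_const[OF assms(1,2), symmetric]
  using assms by (intro mult_right_mono ennpowr_mono mult_left_mono) auto

lemma nn_integral_powr_0:
  assumes "0 < r" "0 \<le> \<beta>"
  shows "(\<integral>\<^sup>+t. ennreal (t powr (r - 1)) * indicator {0<..<\<beta>} t \<partial>lborel) = ennreal (\<beta> powr r / r)"
proof -
  have "((\<lambda>t. t powr (r - 1)) has_integral (\<beta> powr (r - 1 + 1) / (r - 1 + 1))) {0..\<beta>}"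
    using assms by (intro has_integral_powr_from_0) auto
  then have "((\<lambda>t. t powr (r - 1)) has_integral (\<beta> powr r / r)) {0<..<\<beta>}"
    using has_integral_Icc_iff_Ioo by fastforce
  then have "(\<integral>\<^sup>+t. ennreal (indicator {0<..<\<beta>} t * t powr (r - 1)) \<partial>lborel)
      = ennreal (\<beta> powr r / r)"
    by (intro nn_integral_has_integral_lebesgue) auto
  then show ?thesis
    by (simp add: ennreal_mult' ennreal_indicator mult.commute)
qed

text \<open>The rearrangement is at most \<open>b\<close> before \<open>L\<close> and vanishes from
  \<open>L\<close> on, so the integral of \<open>t^(r-1)\<close> over \<open>(0,L)\<close>
  decides.\<close>

lemma qnorm_pow_bounded_support:
  assumes "0 < r" "0 \<le> L" "0 < b" and le: "\<And>x. x \<in> I \<Longrightarrow> norm (f x) \<le> b"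
    and supp: "\<And>l. 0 < l \<Longrightarrow> emeasure (lebesgue_on I) {x \<in> I. l < norm (f x)} \<le> ennreal L"
  shows "qnorm_pow (2 * r) I f \<le> ennreal (b powr (2 * r) * (L powr r / r))"
proof -
  have "qnorm_pow (2 * r) I f \<le> (\<integral>\<^sup>+t. ennreal (b powr (2 * r)) * (ennreal (t powr (r - 1)) *
      indicator {0<..<L} t) \<partial>lborel)"
    unfolding qnorm_pow_def
  proof (rule nn_integral_mono)
    fix t :: real
    show "ennpowr (ennreal (t powr (1/2)) * rearrangement I f t) (2 * r) * ennreal (1 / t) *
        indicator {0<..} t
      \<le> ennreal (b powr (2 * r)) * (ennreal (t powr (r - 1)) * indicator {0<..<L} t)"
    proof (cases "0 < t \<and> t < L")
      case True
      have e: "{x \<in> I. b < norm (f x)} = {}" using le by (auto simp: not_less)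
      have "rearrangement I f t \<le> ennreal b"
        using \<open>0 < b\<close> by (intro rearrangement_le) (simp_all add: e)
      then show ?thesis
        using integrand_le[of t b I f r] True assms by (simp add: mult.assoc)
    next
      case False
      have "rearrangement I f t = 0" if "L \<le> t"
        using that by (intro rearrangement_eq_0 order_trans[OF supp]) (auto intro: ennreal_leI)
      then show ?thesis
        using False by (auto simp: ennpowr_def not_less)
    qed
  qed
  also have "\<dots> = ennreal (b powr (2 * r)) * ennreal (L powr r / r)"
    using assms by (simp add: nn_integral_cmult nn_integral_powr_0)
  also have "\<dots> = ennreal (b powr (2 * r) * (L powr r / r))"
    using assms by (intro ennreal_mult[symmetric]) auto
  finally show ?thesis .
qed

lemma sum_geometric_le:
  fixes x :: real
  assumes "0 \<le> x" "x < 1"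
  shows "(\<Sum>j=a..<n. x ^ j) \<le> x ^ a / (1 - x)"
proof -
  have "(1 - x) * (\<Sum>j=a..<n. x ^ j) = x ^ a - x ^ n" if "a \<le> n"
    using that
  proof (induction n rule: dec_induct)
    case (step n)
    then show ?case by (simp add: distrib_left) (simp add: algebra_simps)
  qed simp
  then have "(1 - x) * (\<Sum>j=a..<n. x ^ j) \<le> x ^ a"
    using assms by (cases "a \<le> n") auto
  then show ?thesis
    using assms by (simp add: field_simps)
qed

text \<open>At a fixed \<open>t\<close>, the levels whose superlevel sets are known to have measure
  above \<open>t\<close> form part of a geometric sequence; the factor \<open>1 - (1/4)^r\<close>
  makes their sum at most the contribution of the highest one, which the rearrangement attains. Thus
  disjointness of the ranges of \<open>t\<close> is not at issue.\<close>

lemma qnorm_pow_lower: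
  fixes f :: "real \<Rightarrow> 'a::{real_normed_field, euclidean_space}"
  assumes f: "f \<in> borel_measurable (lebesgue_on I)" and r: "0 < r" and L: "0 < L"
    and \<beta>: "\<And>j. j < n \<Longrightarrow> 0 \<le> \<beta> j"
      "\<And>j. j < n \<Longrightarrow> ennreal (\<beta> j) \<le> emeasure (lebesgue_on I) {x \<in> I. L / 2 ^ j < norm (f x)}"
  shows "ennreal ((1 - (1 / 4) powr r) / r * (\<Sum>j<n. ((L / 2 ^ j)\<^sup>2 * \<beta> j) powr r))
      \<le> qnorm_pow (2 * r) I f"
proof -
  define x where "x = (1 / 4 :: real) powr r"
  have x: "0 < x" "x < 1"
    using r powr_less_mono2[of r "1 / 4 :: real" 1] by (auto simp: x_def)
  have lev: "(L / 2 ^ j) powr (2 * r) = L powr (2 * r) * x ^ j" for j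
  proof -
    have "(2 ^ j) powr (2 * r) = ((2 ^ j)\<^sup>2) powr r" for j
      by (simp add: powr_powr[symmetric])
    also have "\<And>j. (2 ^ j)\<^sup>2 = (4 ^ j :: real)"
      by (simp add: power2_eq_square flip: power_mult_distrib)
    also have "\<And>j. (4 ^ j) powr r = (4 powr r) ^ j"
      by (induct_tac j) (simp_all add: powr_mult)
    finally have "(2 ^ j) powr (2 * r) = (4 powr r) ^ j" .
    then show ?thesis
      using L by (simp add: powr_divide x_def power_divide)
  qed
  have "ennreal ((1 - x) / r * (\<Sum>j<n. ((L / 2 ^ j)\<^sup>2 * \<beta> j) powr r)) =
      (\<Sum>j<n. ennreal ((1 - x) * (L / 2 ^ j) powr (2 * r)) * ennreal (\<beta> j powr r / r))"
  proof -
    have "((L / 2 ^ j)\<^sup>2 * \<beta> j) powr r = (L / 2 ^ j) powr (2 * r) * \<beta> j powr r" if "j < n" for j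
      using L \<beta>(1)[OF that] by (simp add: powr_mult powr_powr[symmetric])
    then have eq: "(1 - x) / r * (\<Sum>j<n. ((L / 2 ^ j)\<^sup>2 * \<beta> j) powr r) =
        (\<Sum>j<n. ((1 - x) * (L / 2 ^ j) powr (2 * r)) * (\<beta> j powr r / r))"
      unfolding sum_distrib_left by (intro sum.cong) auto
    show ?thesis
      unfolding eq using x r by (simp flip: ennreal_mult)
  qed
  also have "\<dots> = (\<Sum>j<n. \<integral>\<^sup>+t. ennreal ((1 - x) * (L / 2 ^ j) powr (2 * r)) *
      (ennreal (t powr (r - 1)) * indicator {0<..<\<beta> j} t) \<partial>lborel)"
    using r \<beta>(1) by (intro sum.cong) (auto simp: nn_integral_cmult nn_integral_powr_0)
  also have "\<dots> = (\<integral>\<^sup>+t. (\<Sum>j<n. ennreal ((1 - x) * (L / 2 ^ j) powr (2 * r)) *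
      (ennreal (t powr (r - 1)) * indicator {0<..<\<beta> j} t)) \<partial>lborel)"
    by (intro nn_integral_sum[symmetric]) auto
  also have "\<dots> \<le> qnorm_pow (2 * r) I f"
    unfolding qnorm_pow_def
  proof (rule nn_integral_mono)
    fix t :: real
    let ?J = "ennpowr (ennreal (t powr (1/2)) * rearrangement I f t) (2 * r) * ennreal (1 / t) *
        indicator {0<..} t"
    define Z where "Z = {j. j < n \<and> 0 < t \<and> t < \<beta> j}"
    show "(\<Sum>j<n. ennreal ((1 - x) * (L / 2 ^ j) powr (2 * r)) * (ennreal (t powr (r - 1)) *
        indicator {0<..<\<beta> j} t)) \<le> ?J"
    proof (cases "Z = {}")
      case True
      then have "(\<Sum>j<n. ennreal ((1 - x) * (L / 2 ^ j) powr (2 * r)) * (ennreal (t powr (r - 1)) *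
          indicator {0<..<\<beta> j} t)) = 0"
        by (intro sum.neutral) (auto simp: Z_def indicator_def)
      then show ?thesis by (simp only: zero_le)
    next
      case False
      \<comment> \<open>Levels decrease in \<open>j\<close>, so the least index is the highest
        level.\<close>
      define a where "a = (LEAST j. j \<in> Z)"
      have a: "a \<in> Z" unfolding a_def using False by (auto intro: LeastI)
      then have t: "0 < t" and an: "a < n" "t < \<beta> a" by (auto simp: Z_def)
      have Za: "Z \<subseteq> {a..<n}" unfolding a_def by (auto simp: Z_def intro: Least_le)
      have "(\<Sum>j<n. ennreal ((1 - x) * (L / 2 ^ j) powr (2 * r)) * (ennreal (t powr (r - 1)) *
          indicator {0<..<\<beta> j} t)) =
        (\<Sum>j\<in>Z. ennreal ((1 - x) * (L / 2 ^ j) powr (2 * r)) * ennreal (t powr (r - 1)))"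
        by (intro sum.mono_neutral_cong_right) (auto simp: Z_def indicator_def)
      also have "\<dots> = ennreal (\<Sum>j\<in>Z. (1 - x) * (L / 2 ^ j) powr (2 * r)) * ennreal (t powr (r - 1))"
        using x by (simp add: sum_distrib_right[symmetric])
      also have "\<dots> \<le> ennreal ((L / 2 ^ a) powr (2 * r)) * ennreal (t powr (r - 1))"
      proof (intro mult_right_mono ennreal_leI)
        have "(\<Sum>j\<in>Z. (1 - x) * (L / 2 ^ j) powr (2 * r))
            \<le> (\<Sum>j=a..<n. (1 - x) * (L / 2 ^ j) powr (2 * r))"
          using x Za by (intro sum_mono2) auto
        also have "\<dots> = (1 - x) * L powr (2 * r) * (\<Sum>j=a..<n. x ^ j)"
          unfolding lev by (simp add: sum_distrib_left mult.assoc)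
        also have "\<dots> \<le> (1 - x) * L powr (2 * r) * (x ^ a / (1 - x))"
          using x by (intro mult_left_mono sum_geometric_le) auto
        also have "\<dots> = (L / 2 ^ a) powr (2 * r)"
          using x by (simp add: lev)
        finally show "(\<Sum>j\<in>Z. (1 - x) * (L / 2 ^ j) powr (2 * r)) \<le> (L / 2 ^ a) powr (2 * r)" .
      qed auto
      also have "\<dots> \<le> ?J"
      proof -
        have "ennreal t < ennreal (\<beta> a)" using t an by (intro ennreal_lessI) auto
        also have "\<dots> \<le> emeasure (lebesgue_on I) {x \<in> I. L / 2 ^ a < norm (f x)}"
            by (rule \<beta>(2)[OF an(1)])
        finally have "ennreal (L / 2 ^ a) \<le> rearrangement I f t" by (rule rearrangement_ge[OF f])
        then show ?thesis using integrand_ge[of t "L / 2 ^ a" I f r] t L r by simp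
      qed
      finally show ?thesis .
    qed
  qed
  finally show ?thesis unfolding x_def .
qed

section \<open>Dyadic bounds for the quasi-norm on the unit interval\<close>

lemma unit_interval_measure:
  "finite_measure (lebesgue_on {0<..<1::real})"
  "measure (lebesgue_on {0<..<1::real}) (space (lebesgue_on {0<..<1})) = 1"
proof -
  have e: "emeasure (lebesgue_on {0<..<1::real}) (space (lebesgue_on {0<..<1})) = 1"
    by (simp add: emeasure_restrict_space)
  show "finite_measure (lebesgue_on {0<..<1::real})"
    by (rule finite_measureI) (simp only: e infinity_ennreal_def ennreal_one_neq_top
        not_False_eq_True)
  show "measure (lebesgue_on {0<..<1::real}) (space (lebesgue_on {0<..<1})) = 1"
    using e by (simp add: measure_def)
qed

lemma emeasure_superlevel_unit:
  "emeasure (lebesgue_on {0<..<1}) {x \<in> {0<..<1}. l < norm (f x)}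
      = ennreal (tail (lebesgue_on {0<..<1::real}) f l)"
  using finite_measure.emeasure_eq_measure[OF unit_interval_measure(1)] by (simp add: tail_def)

lemma qnorm_pow_lower_unit:
  fixes f :: "real \<Rightarrow> 'a::{real_normed_field, euclidean_space}"
  assumes f: "f \<in> borel_measurable (lebesgue_on {0<..<1})" and r: "0 < r"
  shows "ennreal ((1 - (1 / 4) powr r) / (r * 4 powr r) *
    (\<Sum>k<n. (4 ^ k * tail (lebesgue_on {0<..<1}) f (2 ^ k / 2)) powr r))
        \<le> qnorm_pow (2 * r) {0<..<1} f"
proof -
  let ?t = "\<lambda>k. tail (lebesgue_on {0<..<1}) f (2 ^ k / 2)"
  \<comment> \<open>Starting from \<open>L = 2^n / 4\<close> and reversing the index turns the
    descending levels of \<open>qnorm_pow_lower\<close> into \<open>2^k / 2\<close> for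
    \<open>k < n\<close>.\<close>
  have lev: "(2 ^ n / 4 :: real) / 2 ^ j = 2 ^ (n - Suc j) / 2" if "j < n" for j
  proof -
    have "(2::real) ^ n = 2 ^ (n - Suc j) * 2 ^ Suc j"
      using that by (subst power_add[symmetric]) simp
    then show ?thesis by simp
  qed
  have four: "(2 ^ k / 2)\<^sup>2 = (4 ^ k / 4 :: real)" for k :: nat
    by (simp add: power_divide power2_eq_square[of "2 ^ k"] flip: power_mult_distrib)
  have "(\<Sum>j<n. ((2 ^ n / 4 / 2 ^ j)\<^sup>2 * ?t (n - Suc j)) powr r)
      = (\<Sum>j<n. ((2 ^ (n - Suc j) / 2)\<^sup>2 * ?t (n - Suc j)) powr r)"
    by (intro sum.cong refl) (simp only: lev lessThan_iff)
  also have "\<dots> = (\<Sum>k<n. ((2 ^ k / 2)\<^sup>2 * ?t k) powr r)"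
    by (rule sum.nat_diff_reindex[of "\<lambda>k. ((2 ^ k / 2)\<^sup>2 * ?t k) powr r" n])
  also have "\<dots> = (\<Sum>k<n. (4 ^ k * ?t k) powr r / 4 powr r)"
    unfolding four times_divide_eq_left by (simp add: powr_divide tail_nonneg)
  finally have eq: "(1 - (1 / 4) powr r) / r * (\<Sum>j<n. ((2 ^ n / 4 / 2 ^ j)\<^sup>2 * ?t (n - Suc j))
      powr r) =
    (1 - (1 / 4) powr r) / (r * 4 powr r) * (\<Sum>k<n. (4 ^ k * ?t k) powr r)"
    by (simp add: sum_divide_distrib[symmetric])
  show ?thesis
    unfolding eq[symmetric]
  proof (rule qnorm_pow_lower[OF f r])
    fix j assume "j < n"
    then show "ennreal (?t (n - Suc j)) \<le> emeasure (lebesgue_on {0<..<1}) {x \<in> {0<..<1}. 2 ^ n / 4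
        / 2 ^ j < norm (f x)}"
      by (simp only: lev emeasure_superlevel_unit order_refl)
  qed (auto simp: tail_nonneg)
qed

text \<open>Let \<open>K\<close> be the first \<open>k\<close> whose tail at \<open>2^k\<close> is
  at most \<open>t\<close>; then the rearrangement at \<open>t\<close> is at most
  \<open>2^K\<close>. If \<open>K = 0\<close> this is charged to the summand 1; if
  \<open>K = k + 1\<close>, then \<open>t\<close> lies below the tail at \<open>2^k\<close> and the
  \<open>k\<close>-th term pays, the extra level costing \<open>4^r\<close>. For
  \<open>t >= 1\<close> the rearrangement vanishes because the total mass is 1.\<close>

lemma qnorm_pow_upper_unit:
  fixes f :: "real \<Rightarrow> 'a::{real_normed_field, euclidean_space}"
  assumes r: "0 < r"
  shows "qnorm_pow (2 * r) {0<..<1} f \<le> ennreal (4 powr r / r) *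
    (1 + (\<Sum>k. ennreal ((4 ^ k * tail (lebesgue_on {0<..<1}) f (2 ^ k)) powr r)))"
proof -
  let ?t = "\<lambda>k::nat. tail (lebesgue_on {0<..<1}) f (2 ^ k)"
  let ?g = "\<lambda>t. ennreal (t powr (r - 1))"
  define c where "c k = 4 powr r * (4 ^ k) powr r" for k :: nat
  have c1: "1 \<le> c k" for k
    unfolding c_def using r mult_mono[of 1 "4 powr r" 1 "(4 ^ k) powr r"]
    by (simp add: ge_one_powr_ge_zero)
  have lev: "(2 ^ Suc k) powr (2 * r) = c k" for k
  proof -
    have "(2 ^ Suc k) powr (2 * r) = ((2 ^ Suc k)\<^sup>2) powr r"
      by (simp add: powr_powr[symmetric])
    also have "(2 ^ Suc k)\<^sup>2 = (4 * 4 ^ k :: real)"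
      by (simp add: power2_eq_square flip: power_mult_distrib)
    finally show ?thesis by (simp add: c_def powr_mult)
  qed
  have "qnorm_pow (2 * r) {0<..<1} f \<le> (\<integral>\<^sup>+t. ?g t * indicator {0<..<1} t +
      (\<Sum>k. ennreal (c k) * (?g t * indicator {0<..<?t k} t)) \<partial>lborel)"
    unfolding qnorm_pow_def
  proof (rule nn_integral_mono)
    fix t :: real
    let ?J = "ennpowr (ennreal (t powr (1/2)) * rearrangement {0<..<1} f t) (2 * r) * ennreal (1 /
        t)"
    let ?S = "\<Sum>k. ennreal (c k) * (?g t * indicator {0<..<?t k} t)"
    have Sk: "(\<Sum>k<n. ennreal (c k) * (?g t * indicator {0<..<?t k} t)) \<le> ?S" for n
      by (intro sum_le_suminf) auto
    show "?J * indicator {0<..} t \<le> ?g t * indicator {0<..<1} t + ?S"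
    proof (cases "0 < t \<and> t < 1")
      case True
      show ?thesis
      proof (cases "\<exists>k. ?t k \<le> t")
        case ex: True
        define K where "K = (LEAST k. ?t k \<le> t)"
        have K: "?t K \<le> t" unfolding K_def using ex by (rule LeastI_ex)
        have "rearrangement {0<..<1} f t \<le> ennreal (2 ^ K)"
        proof (rule rearrangement_le)
          show "emeasure (lebesgue_on {0<..<1}) {x \<in> {0<..<1}. 2 ^ K < norm (f x)} \<le> ennreal t"
            unfolding emeasure_superlevel_unit using K by (rule ennreal_leI)
        qed simp
        then have J: "?J \<le> ennreal ((2 ^ K) powr (2 * r)) * ?g t"
          using True r by (intro integrand_le) auto
        show ?thesis
        proof (cases K)
          case 0
          then show ?thesis using J True by (simp add: add_increasing2)
        next
          case (Suc k)
          have "t < ?t k"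
            using not_less_Least[of k "\<lambda>k. ?t k \<le> t"] Suc unfolding K_def by simp
          then have "?J \<le> ennreal (c k) * (?g t * indicator {0<..<?t k} t)"
            using J True unfolding Suc lev by simp
          also have "\<dots> \<le> (\<Sum>k<Suc k. ennreal (c k) * (?g t * indicator {0<..<?t k} t))"
            by (intro member_le_sum) auto
          also have "\<dots> \<le> ?S" by (rule Sk)
          finally show ?thesis using True by (simp add: add_increasing)
        qed
      next
        case False
        \<comment> \<open>With no such \<open>K\<close> every term is active at \<open>t\<close>,
          and the weights \<open>c k >= 1\<close> make the series diverge.\<close>
        have "?S = \<infinity>"
        proof (rule ccontr)
          assume "?S \<noteq> \<infinity>"
          then obtain s where s: "?S = ennreal s" "0 \<le> s"
            by (cases ?S rule: ennreal_cases) auto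
          have le: "real n * t powr (r - 1) \<le> s" for n
          proof -
            have "ennreal (real n * t powr (r - 1)) = (\<Sum>k<n. ?g t)"
              by (simp add: ennreal_mult' ennreal_of_nat_eq_real_of_nat)
            also have "\<dots> \<le> (\<Sum>k<n. ennreal (c k) * (?g t * indicator {0<..<?t k} t))"
            proof (rule sum_mono)
              fix k
              have "t powr (r - 1) \<le> c k * t powr (r - 1)"
                using c1[of k] by (simp add: mult_le_cancel_right1)
              then show "?g t \<le> ennreal (c k) * (?g t * indicator {0<..<?t k} t)"
                using False True c1[of k] by (simp add: not_le ennreal_mult'[symmetric] ennreal_leI)
            qed
            also have "\<dots> \<le> ennreal s" unfolding s(1)[symmetric] by (rule Sk)
            finally show ?thesis using s(2) by simp
          qed
          have "0 < t powr (r - 1)" using True by simp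
          then obtain n where "s < of_nat n * t powr (r - 1)"
            using ex_less_of_nat_mult by blast
          then show False using le[of n] by simp
        qed
        then show ?thesis by simp
      qed
    next
      case False
      have "rearrangement {0<..<1} f t = 0" if "1 \<le> t"
      proof (rule rearrangement_eq_0)
        fix l :: real
        show "emeasure (lebesgue_on {0<..<1}) {x \<in> {0<..<1}. l < norm (f x)} \<le> ennreal t"
          unfolding emeasure_superlevel_unit
          using tail_le_1[OF unit_interval_measure, of f l] that by (intro ennreal_leI) simp
      qed
      then show ?thesis
        using False by (auto simp: ennpowr_def not_less)
    qed
  qed
  also have "\<dots> = ennreal (1 / r) + (\<Sum>k. ennreal (c k) * ennreal (?t k powr r / r))"
  proof -
    have "(\<integral>\<^sup>+t. ?g t * indicator {0<..<1} t \<partial>lborel) = ennreal (1 / r)"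
      using nn_integral_powr_0[OF r, of 1] by simp
    moreover have "(\<integral>\<^sup>+t. (\<Sum>k. ennreal (c k) * (?g t * indicator {0<..<?t k} t)) \<partial>lborel) =
        (\<Sum>k. ennreal (c k) * ennreal (?t k powr r / r))"
      using r by (simp add: nn_integral_suminf nn_integral_cmult nn_integral_powr_0 tail_nonneg)
    ultimately show ?thesis
      by (subst nn_integral_add) auto
  qed
  also have "(\<lambda>k. ennreal (c k) * ennreal (?t k powr r / r))
      = (\<lambda>k. ennreal (4 powr r / r) * ennreal ((4 ^ k * ?t k) powr r))"
    using r by (auto simp: c_def powr_mult tail_nonneg simp flip: ennreal_mult)
  also have "ennreal (1 / r) + (\<Sum>k. ennreal (4 powr r / r) * ennreal ((4 ^ k * ?t k) powr r)) \<le>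
      ennreal (4 powr r / r) + ennreal (4 powr r / r) * (\<Sum>k. ennreal ((4 ^ k * ?t k) powr r))"
    using r ge_one_powr_ge_zero[of 4 r]
    by (auto intro!: add_mono ennreal_leI divide_right_mono)
  finally show ?thesis
    by (simp add: distrib_left)
qed

section \<open>Step functions on the half-line\<close>

definition unit_step :: "nat \<Rightarrow> real \<Rightarrow> 'a::real_normed_field" where
  "unit_step i x = (if real i \<le> x \<and> x < real i + 1 then 1 else 0)"

definition step_fun :: "nat set \<Rightarrow> (nat \<Rightarrow> 'a::real_normed_field) \<Rightarrow> real \<Rightarrow> 'a" where
  "step_fun A c x = (\<Sum>i\<in>A. c i * unit_step i x)"

lemma step_value:
  assumes "finite A" "real i \<le> x" "x < real i + 1"
  shows "step_fun A c x = (if i \<in> A then c i else 0)"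
proof -
  have "unit_step j x = (if i = j then 1 else 0 :: 'a)" for j
    using assms by (auto simp: unit_step_def)
  then show ?thesis
    using assms by (simp add: step_fun_def if_distrib[of "(*) _"] cong: if_cong)
qed

lemma step_value_floor:
  assumes "finite A" "0 < x"
  shows "step_fun A c x = (if nat \<lfloor>x\<rfloor> \<in> A then c (nat \<lfloor>x\<rfloor>) else 0)"
  using assms by (intro step_value) linarith+

lemma step_measurable:
  fixes c :: "nat \<Rightarrow> 'a::{real_normed_field, euclidean_space}"
  shows "step_fun A c \<in> borel_measurable (lebesgue_on I)"
proof -
  have "step_fun A c \<in> borel_measurable lborel"
    unfolding step_fun_def[abs_def] unit_step_def by measurable
  then show ?thesis
    by (intro measurable_restrict_space1 measurable_completion)
qed

lemma step_support:
  assumes "finite A" "0 < l"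
  shows "emeasure (lebesgue_on {0<..}) {x \<in> {0<..}. l < norm (step_fun A c x)} \<le> ennreal (card A)"
proof -
  let ?U = "\<Union>i\<in>A. {real i..<real i + 1}"
  have U: "?U \<in> sets lebesgue" by (intro sets.finite_UN assms) auto
  have "emeasure (lebesgue_on {0<..}) {x \<in> {0<..}. l < norm (step_fun A c x)}
      \<le> emeasure (lebesgue_on {0<..}) (?U \<inter> {0<..})"
  proof (rule emeasure_mono)
    show "?U \<inter> {0<..} \<in> sets (lebesgue_on {0<..})"
      using U by (simp add: sets_restrict_space_iff)
    show "{x \<in> {0<..}. l < norm (step_fun A c x)} \<subseteq> ?U \<inter> {0<..}"
    proof clarify
      fix x :: real assume x: "0 < x" "l < norm (step_fun A c x)"
      then have "nat \<lfloor>x\<rfloor> \<in> A"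
        using assms by (auto simp: step_value_floor split: if_splits)
      moreover have "x \<in> {real (nat \<lfloor>x\<rfloor>)..<real (nat \<lfloor>x\<rfloor>) + 1}"
        using x by simp
      ultimately have "x \<in> ?U" by (rule UN_I)
      then show "x \<in> ?U \<inter> {0<..}" using x by simp
    qed
  qed
  also have "\<dots> = emeasure lebesgue (?U \<inter> {0<..})"
    by (intro emeasure_restrict_space) auto
  also have "\<dots> \<le> emeasure lebesgue ?U"
    using U by (intro emeasure_mono) auto
  also have "\<dots> \<le> (\<Sum>i\<in>A. emeasure lebesgue {real i..<real i + 1})"
    using assms by (intro emeasure_subadditive_finite) auto
  also have "\<dots> = ennreal (card A)"
    by (simp add: ennreal_of_nat_eq_real_of_nat)
  finally show ?thesis .
qed

lemma step_superlevel:
  fixes c :: "nat \<Rightarrow> 'a::{real_normed_field, euclidean_space}"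
  assumes "finite A" "A' \<subseteq> A" "\<And>i. i \<in> A' \<Longrightarrow> l < norm (c i)"
  shows "ennreal (card A') \<le> emeasure (lebesgue_on {0<..}) {x \<in> {0<..}. l < norm (step_fun A c x)}"
proof -
  \<comment> \<open>Open intervals here, because the left endpoint 0 of the first step lies outside
    \<open>{0<..}\<close>.\<close>
  let ?U = "\<Union>i\<in>A'. {real i<..<real i + 1}"
  have fin: "finite A'" using assms finite_subset by blast
  have "disjoint_family_on (\<lambda>i. {real i<..<real i + 1}) A'"
    by (auto simp: disjoint_family_on_def)
  then have "(\<Sum>i\<in>A'. emeasure lebesgue {real i<..<real i + 1}) = emeasure lebesgue ?U"
    using fin by (intro sum_emeasure) auto
  then have "ennreal (card A') = emeasure lebesgue ?U"
    by (simp add: ennreal_of_nat_eq_real_of_nat)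
  also have "\<dots> = emeasure (lebesgue_on {0<..}) ?U"
    by (intro emeasure_restrict_space[symmetric]) (auto intro: le_less_trans[OF of_nat_0_le_iff])
  also have "\<dots> \<le> emeasure (lebesgue_on {0<..}) {x \<in> {0<..}. l < norm (step_fun A c x)}"
  proof (intro emeasure_mono superlevel_sets step_measurable)
    show "?U \<subseteq> {x \<in> {0<..}. l < norm (step_fun A c x)}"
    proof clarify
      fix x i assume i: "i \<in> A'" "x \<in> {real i<..<real i + 1}"
      then have "step_fun A c x = c i"
        using assms by (subst step_value[of A i]) auto
      moreover have "0 < x" using i by (auto intro: le_less_trans[OF of_nat_0_le_iff])
      ultimately show "x \<in> {0<..} \<and> l < norm (step_fun A c x)" using assms(3)[OF i(1)] by simp
    qed
  qed
  finally show ?thesis .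
qed

lemma qnorm_pow_step_le:
  fixes c :: "nat \<Rightarrow> 'a::{real_normed_field, euclidean_space}"
  assumes "finite A" "0 < r" "0 < b" "\<And>i. i \<in> A \<Longrightarrow> norm (c i) \<le> b"
  shows "qnorm_pow (2 * r) {0<..} (step_fun A c)
      \<le> ennreal (b powr (2 * r) * (real (card A) powr r / r))"
  using assms by (intro qnorm_pow_bounded_support step_support) (auto simp: step_value_floor
      less_imp_le)

section \<open>Passing step functions through an embedding\<close>

lemma L2q_qnorm_eq: "L2q_qnorm q I f = ennpowr (qnorm_pow q I f) (1 / q)"
  by (simp only: L2q_qnorm_def qnorm_pow_def)

lemma L2q_iff: "0 < q \<Longrightarrow> f \<in> L2q q I \<longleftrightarrow> f \<in> borel_measurable (lebesgue_on I) \<and> qnorm_pow q I f < \<infinity>"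
  by (auto simp: L2q_def L2q_qnorm_eq ennpowr_def less_top)

lemma step_in_L2q:
  fixes c :: "nat \<Rightarrow> 'a::{real_normed_field, euclidean_space}"
  assumes "finite A" "0 < r"
  shows "step_fun A c \<in> L2q (2 * r) {0<..}"
proof -
  define b where "b = 1 + (\<Sum>i\<in>A. norm (c i))"
  have "norm (c i) \<le> b" if "i \<in> A" for i
    using member_le_sum[of i A "\<lambda>i. norm (c i)"] assms that by (simp add: b_def)
  moreover have "0 < b" by (simp add: b_def add_pos_nonneg sum_nonneg)
  ultimately have "qnorm_pow (2 * r) {0<..} (step_fun A c)
      \<le> ennreal (b powr (2 * r) * (real (card A) powr r / r))"
    using assms by (intro qnorm_pow_step_le)
  also have "\<dots> < \<infinity>" by simp
  finally show ?thesis
    using assms by (simp add: L2q_iff step_measurable)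
qed

text \<open>The image of a step function is a combination of the images of unit steps only almost
  everywhere; this lets the two be exchanged.\<close>

lemma qnorm_pow_cong_AE:
  fixes f g :: "real \<Rightarrow> 'a::{real_normed_field, euclidean_space}"
  assumes "f \<in> borel_measurable (lebesgue_on I)" "g \<in> borel_measurable (lebesgue_on I)"
    and "AE x in lebesgue_on I. f x = g x"
  shows "qnorm_pow q I f = qnorm_pow q I g"
proof -
  have "emeasure (lebesgue_on I) {x \<in> I. l < norm (f x)}
      = emeasure (lebesgue_on I) {x \<in> I. l < norm (g x)}" for l
    using assms(3) by (intro emeasure_eq_AE superlevel_sets assms(1,2)) auto
  then have "rearrangement I f t = rearrangement I g t" for t
    by (simp add: rearrangement_def)
  then show ?thesis by (simp add: qnorm_pow_def)
qed

lemma embedding_qnorm_pow: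
  fixes T :: "(real \<Rightarrow> 'a::{real_normed_field, euclidean_space}) \<Rightarrow> (real \<Rightarrow> 'a)"
  assumes "L2q_embedding q I J T" "0 < q"
  shows "\<exists>K>0. \<forall>f\<in>L2q q I. qnorm_pow q J (T f) \<le> ennreal K * qnorm_pow q I f \<and> qnorm_pow q I f
      \<le> ennreal K * qnorm_pow q J (T f)"
proof -
  obtain C where C: "1 \<le> C" and bd: "\<And>f. f \<in> L2q q I \<Longrightarrow>
      ennreal (1 / C) * L2q_qnorm q I f \<le> L2q_qnorm q J (T f) \<and> L2q_qnorm q J (T f)
          \<le> ennreal C * L2q_qnorm q I f"
    and TL: "\<And>f. f \<in> L2q q I \<Longrightarrow> T f \<in> L2q q J"
    using assms(1) unfolding L2q_embedding_def by blast
  have "qnorm_pow q J (T f) \<le> ennreal (C powr q) * qnorm_pow q I f \<and> qnorm_pow q I f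
      \<le> ennreal (C powr q) * qnorm_pow q J (T f)"
    if f: "f \<in> L2q q I" for f
  proof -
    obtain x where x: "qnorm_pow q I f = ennreal x" "0 \<le> x"
      using f assms by (cases "qnorm_pow q I f" rule: ennreal_cases) (auto simp: L2q_iff)
    obtain y where y: "qnorm_pow q J (T f) = ennreal y" "0 \<le> y"
      using TL[OF f] assms by (cases "qnorm_pow q J (T f)" rule: ennreal_cases) (auto simp: L2q_iff)
    have nx: "L2q_qnorm q I f = ennreal (x powr (1 / q))" and ny: "L2q_qnorm q J (T f)
        = ennreal (y powr (1 / q))"
      using x y by (simp_all add: L2q_qnorm_eq ennpowr_ennreal)
    have "1 / C * x powr (1 / q) \<le> y powr (1 / q)" "y powr (1 / q) \<le> C * x powr (1 / q)"
      using bd[OF f] C unfolding nx ny by (simp_all flip: ennreal_mult)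
    then have "x powr (1 / q) \<le> C * y powr (1 / q)" "y powr (1 / q) \<le> C * x powr (1 / q)"
      using C by (simp_all add: field_simps)
    then have "(x powr (1 / q)) powr q \<le> (C * y powr (1 / q)) powr q" "(y powr (1 / q)) powr q
        \<le> (C * x powr (1 / q)) powr q"
      using assms by (auto intro!: powr_mono2)
    then have "x \<le> C powr q * y" "y \<le> C powr q * x"
      using assms x y C by (simp_all add: powr_mult powr_powr)
    then show ?thesis
      unfolding x(1) y(1) using x(2) y(2) by (auto simp flip: ennreal_mult intro!: ennreal_leI)
  qed
  then show ?thesis
    using C by (intro exI[of _ "C powr q"]) auto
qed

lemma embedding_step:
  fixes T :: "(real \<Rightarrow> 'a::{real_normed_field, euclidean_space}) \<Rightarrow> (real \<Rightarrow> 'a)"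
  assumes T: "L2q_embedding (2 * r) {0<..} J T" and "0 < r" "finite A"
  shows "AE x in lebesgue_on J. T (step_fun A c) x = (\<Sum>i\<in>A. c i * T (unit_step i) x)"
proof -
  have T_add: "\<And>f g. f \<in> L2q (2 * r) {0<..} \<Longrightarrow> g \<in> L2q (2 * r) {0<..} \<Longrightarrow>
      AE x in lebesgue_on J. T (\<lambda>y. f y + g y) x = T f x + T g x"
    and T_scale: "\<And>c f. f \<in> L2q (2 * r) {0<..} \<Longrightarrow> AE x in lebesgue_on J. T (\<lambda>y. c * f y) x
        = c * T f x"
    using T unfolding L2q_embedding_def by blast+
  show ?thesis
    using assms(3)
  proof (induction A rule: finite_induct)
    case empty
    have z: "step_fun {} c = (\<lambda>_. 0)" for c :: "nat \<Rightarrow> 'a" by (simp add: step_fun_def[abs_def])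
    have "(\<lambda>_. 0 :: 'a) \<in> L2q (2 * r) {0<..}"
      using step_in_L2q[of "{}" r c] \<open>0 < r\<close> by (simp add: z)
    \<comment> \<open>Homogeneity with scalar 0 gives the image of the zero function.\<close>
    then have "AE x in lebesgue_on J. T (\<lambda>y. 0 * 0) x = 0 * T (\<lambda>_. 0) x"
      by (rule T_scale)
    then show ?case by (simp add: z)
  next
    case (insert i A)
    have u: "unit_step i = (step_fun {i} (\<lambda>_. 1) :: real \<Rightarrow> 'a)"
      by (simp add: step_fun_def[abs_def])
    have uL: "unit_step i \<in> (L2q (2 * r) {0<..} :: (real \<Rightarrow> 'a) set)"
      unfolding u using \<open>0 < r\<close> by (intro step_in_L2q) auto
    have cu: "(\<lambda>y. c i * unit_step i y) = step_fun {i} c"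
      by (simp add: step_fun_def[abs_def])
    have cuL: "(\<lambda>y. c i * unit_step i y) \<in> L2q (2 * r) {0<..}"
      unfolding cu using \<open>0 < r\<close> by (intro step_in_L2q) auto
    have sL: "step_fun A c \<in> L2q (2 * r) {0<..}"
      using insert.hyps \<open>0 < r\<close> by (intro step_in_L2q) auto
    have s: "step_fun (insert i A) c = (\<lambda>y. c i * unit_step i y + step_fun A c y)"
      using insert.hyps by (simp add: step_fun_def[abs_def])
    have "AE x in lebesgue_on J. T (\<lambda>y. c i * unit_step i y + step_fun A c y) x
        = T (\<lambda>y. c i * unit_step i y) x + T (step_fun A c) x"
      using cuL sL by (rule T_add)
    moreover have "AE x in lebesgue_on J. T (\<lambda>y. c i * unit_step i y) x = c i * T (unit_step i) x"
      using uL by (rule T_scale)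
    ultimately show ?case
      using insert.IH unfolding s by eventually_elim (use insert.hyps in simp)
  qed
qed

text \<open>Partial sums need only pass numbers strictly below the bound; this is why
  \<open>c1\<close> is halved below.\<close>

lemma eventually_partial_sums:
  assumes "\<And>k. 0 \<le> x k" "ennreal a \<le> 1 + (\<Sum>k. ennreal (x k))" "0 \<le> a'" "a' < a"
  shows "\<forall>\<^sub>F n in sequentially. a' \<le> 1 + (\<Sum>k<n. x k)"
proof -
  have "(\<lambda>n. \<Sum>k<n. ennreal (x k)) \<longlonglongrightarrow> (\<Sum>k. ennreal (x k))"
    by (intro summable_LIMSEQ) auto
  then have "(\<lambda>n. 1 + (\<Sum>k<n. ennreal (x k))) \<longlonglongrightarrow> 1 + (\<Sum>k. ennreal (x k))"
    by (intro tendsto_add tendsto_const)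
  moreover have "ennreal a' < 1 + (\<Sum>k. ennreal (x k))"
    using assms by (intro less_le_trans[OF ennreal_lessI assms(2)]) auto
  ultimately have "\<forall>\<^sub>F n in sequentially. ennreal a' < 1 + (\<Sum>k<n. ennreal (x k))"
    by (rule order_tendstoD)
  then show ?thesis
  proof eventually_elim
    case (elim n)
    have eq: "1 + (\<Sum>k<n. ennreal (x k)) = ennreal (1 + (\<Sum>k<n. x k))"
      using assms(1) by (simp add: sum_nonneg)
    have "a' < 1 + (\<Sum>k<n. x k)"
      using elim assms(3) unfolding eq by (simp only: ennreal_less_iff)
    then show ?case by simp
  qed
qed

subsection \<open>Embeddings\<close>

text \<open>Block \<open>j\<close> alone supplies \<open>4^(k0+j)\<close> unit intervals of height
  \<open>2^-(k0+j)\<close>. The level is half that height because superlevel sets are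
  strict.\<close>

lemma step_image_superlevel:
  fixes s :: "nat \<times> nat \<Rightarrow> nat"
  assumes s: "inj_on s (Sigma {..<m} (\<lambda>j. {..<4 ^ (k0 + j)}))" and j: "j < m"
    and c: "\<And>x. x \<in> Sigma {..<m} (\<lambda>j. {..<4 ^ (k0 + j)}) \<Longrightarrow>
      norm (c (s x) :: 'a::{real_normed_field, euclidean_space}) = 1 / 2 ^ (k0 + fst x)"
  shows "ennreal (4 ^ (k0 + j)) \<le> emeasure (lebesgue_on {0<..})
    {x \<in> {0<..}. 1 / 2 ^ (k0 + 1) / 2 ^ j < norm (step_fun (s ` Sigma {..<m} (\<lambda>j. {..<4 ^ (k0
        + j)})) c x)}"
proof -
  let ?P = "Sigma {..<m} (\<lambda>j. {..<4 ^ (k0 + j) :: nat})"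
  let ?A' = "s ` ({j} \<times> {..<4 ^ (k0 + j)})"
  have sub: "{j} \<times> {..<4 ^ (k0 + j)} \<subseteq> ?P" using j by auto
  have "card ?A' = 4 ^ (k0 + j)"
    using card_image[OF inj_on_subset[OF s sub]] by simp
  moreover have "ennreal (card ?A') \<le> emeasure (lebesgue_on {0<..})
    {x \<in> {0<..}. 1 / 2 ^ (k0 + 1) / 2 ^ j < norm (step_fun (s ` ?P) c x)}"
  proof (rule step_superlevel)
    fix i assume "i \<in> ?A'"
    then obtain l where l: "l < 4 ^ (k0 + j)" "i = s (j, l)" by auto
    then have "norm (c i) = 1 / 2 ^ (k0 + j)"
      using c[of "(j, l)"] j by simp
    then show "1 / 2 ^ (k0 + 1) / 2 ^ j < norm (c i)"
      by (simp add: power_add field_simps)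
  qed (use sub in auto)
  ultimately show ?thesis by simp
qed

text \<open>The Euclidean structure of the scalars supplies the inner product for the moment
  estimates and covers real and complex scalars at once; signs and dyadic coefficients become
  scalars by \<open>of_real\<close>.\<close>

theorem no_L2q_embedding:
  fixes T :: "(real \<Rightarrow> 'a::{real_normed_field, euclidean_space}) \<Rightarrow> (real \<Rightarrow> 'a)"
  assumes r: "0 < r" "r < 1"
  shows "\<not> L2q_embedding (2 * r) {0<..} {0<..<1} T"
proof
  assume T: "L2q_embedding (2 * r) {0<..} {0<..<1} T"
  obtain K where K: "0 < K" and
    le1: "\<And>f. f \<in> L2q (2 * r) {0<..} \<Longrightarrow> qnorm_pow (2 * r) {0<..<1} (T f)
        \<le> ennreal K * qnorm_pow (2 * r) {0<..} f" and
    le2: "\<And>f. f \<in> L2q (2 * r) {0<..} \<Longrightarrow> qnorm_pow (2 * r) {0<..} f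
        \<le> ennreal K * qnorm_pow (2 * r) {0<..<1} (T f)"
    using embedding_qnorm_pow[OF T] r by auto
  let ?M = "lebesgue_on {0<..<1::real}"
  define f :: "nat \<Rightarrow> real \<Rightarrow> 'a" where "f i = T (unit_step i)" for i
  define F where "F A c t = (\<Sum>i\<in>A. c i * f i t)" for A c t
  have TL: "T g \<in> borel_measurable ?M" if "g \<in> L2q (2 * r) {0<..}" for g
    using T that r unfolding L2q_embedding_def by (auto simp: L2q_iff)
  have fm: "f i \<in> borel_measurable ?M" for i
  proof -
    have "unit_step i = (step_fun {i} (\<lambda>_. 1) :: real \<Rightarrow> 'a)"
      by (simp add: step_fun_def[abs_def])
    then show ?thesis
      unfolding f_def using r by (auto intro!: TL step_in_L2q)
  qed
  have Fm: "F A c \<in> borel_measurable ?M" for A c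
    unfolding F_def[abs_def] using fm by (intro borel_measurable_sum borel_measurable_times) auto
  have QF: "qnorm_pow (2 * r) {0<..<1} (F A c) = qnorm_pow (2 * r) {0<..<1} (T (step_fun A c))"
      if "finite A" for A c
  proof (rule qnorm_pow_cong_AE[OF Fm])
    show "T (step_fun A c) \<in> borel_measurable ?M"
      using that r by (intro TL step_in_L2q)
    show "AE x in ?M. F A c x = T (step_fun A c) x"
      using embedding_step[OF T r(1) that, of c] by eventually_elim (simp add: F_def f_def)
  qed
  define \<kappa> where "\<kappa> = (1 - (1 / 4) powr r) / r"
  have \<kappa>: "0 < \<kappa>"
    using r powr_less_mono2[of r "1 / 4 :: real" 1] by (simp add: \<kappa>_def)
  \<comment> \<open>Each block adds \<open>\<kappa> * (1/4)^r\<close> on the half-line; the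
    embedding constant \<open>K\<close> and the factor of \<open>qnorm_pow_upper_unit\<close> are
    divided out.\<close>
  define c1 where "c1 = \<kappa> * (1 / 4) powr r / (K * (4 powr r / r))"
  have c1: "0 < c1"
    using \<kappa> K r by (simp add: c1_def)
  show False
  proof (rule no_spreading_sequence[OF unit_interval_measure r fm])
    fix A :: "nat set" and e :: "nat \<Rightarrow> real" and w :: real and n :: nat
    assume A: "finite A" and e: "\<And>i. i \<in> A \<Longrightarrow> e i \<in> {-1, 1}" and w: "0 < w"
    define c :: "nat \<Rightarrow> 'a" where "c i = of_real (w * e i)" for i
    have eq: "(\<lambda>t. \<Sum>i\<in>A. (w * e i) *\<^sub>R f i t) = F A c"
      by (simp add: F_def[abs_def] c_def scaleR_conv_of_real)
    have nc: "norm (c i) \<le> w" if "i \<in> A" for i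
      using e[OF that] w unfolding c_def norm_of_real by auto
    let ?S = "\<Sum>k<n. (4 ^ k * tail ?M (F A c) (2 ^ k / 2)) powr r"
    have "ennreal (\<kappa> / 4 powr r * ?S) \<le> qnorm_pow (2 * r) {0<..<1} (F A c)"
      using qnorm_pow_lower_unit[where f = "F A c" and n = n, OF Fm r(1)] by (simp add: \<kappa>_def)
    also have "\<dots> \<le> ennreal K * qnorm_pow (2 * r) {0<..} (step_fun A c)"
      unfolding QF[OF A] using A r by (intro le1 step_in_L2q)
    also have "\<dots> \<le> ennreal K * ennreal (w powr (2 * r) * (real (card A) powr r / r))"
      using A r w nc by (intro mult_left_mono qnorm_pow_step_le) auto
    also have "\<dots> = ennreal (K * (w powr (2 * r) * (real (card A) powr r / r)))"
      using K r by (intro ennreal_mult[symmetric]) auto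
    finally have "\<kappa> / 4 powr r * ?S \<le> K * (w powr (2 * r) * (real (card A) powr r / r))"
      using K r by (subst (asm) ennreal_le_iff) auto
    also have "w powr (2 * r) = (w\<^sup>2) powr r"
      using w by (simp add: powr_powr[symmetric])
    finally show "(\<Sum>k<n. (4 ^ k * tail ?M (\<lambda>t. \<Sum>i\<in>A. (w * e i) *\<^sub>R f i t) (2 ^ k / 2)) powr r)
        \<le> (K * 4 powr r / (r * \<kappa>)) * (w\<^sup>2 * real (card A)) powr r"
      unfolding eq using \<kappa> r by (simp add: powr_mult field_simps)
  next
    show "0 < c1 / 2" using c1 by simp
  next
    fix m k0 and s :: "nat \<times> nat \<Rightarrow> nat" and e :: "nat \<times> nat \<Rightarrow> real"
    let ?P = "Sigma {..<m} (\<lambda>j. {..<4 ^ (k0 + j) :: nat})"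
    assume s: "inj_on s ?P" and e: "\<And>x. x \<in> ?P \<Longrightarrow> e x \<in> {-1, 1}"
    define c :: "nat \<Rightarrow> 'a" where
      "c i = of_real (e (inv_into ?P s i) / 2 ^ (k0 + fst (inv_into ?P s i)))" for i
    have cs: "c (s x) = of_real (e x / 2 ^ (k0 + fst x))" if "x \<in> ?P" for x
      using that s by (simp add: c_def)
    have nc: "norm (c (s x)) = 1 / 2 ^ (k0 + fst x)" if "x \<in> ?P" for x
      using e[OF that] unfolding cs[OF that] norm_of_real by auto
    define A where "A = s ` ?P"
    have A: "finite A" by (simp add: A_def)
    have eq: "(\<lambda>t. \<Sum>x\<in>?P. (e x / 2 ^ (k0 + fst x)) *\<^sub>R f (s x) t) = F A c"
    proof
      fix t
      show "(\<Sum>x\<in>?P. (e x / 2 ^ (k0 + fst x)) *\<^sub>R f (s x) t) = F A c t"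
        unfolding F_def A_def sum.reindex[OF s] o_def
        by (intro sum.cong refl) (simp only: cs scaleR_conv_of_real)
    qed
    let ?x = "\<lambda>k. (4 ^ k * tail ?M (F A c) (2 ^ k)) powr r"
    have "ennreal (\<kappa> * (\<Sum>j<m. ((1 / 2 ^ (k0 + 1) / 2 ^ j)\<^sup>2 * 4 ^ (k0 + j)) powr r))
        \<le> qnorm_pow (2 * r) {0<..} (step_fun A c)"
      unfolding \<kappa>_def
    proof (rule qnorm_pow_lower)
      fix j assume j: "j < m"
      show "ennreal (4 ^ (k0 + j)) \<le> emeasure (lebesgue_on {0<..}) {x \<in> {0<..}. 1 / 2 ^ (k0
          + 1) / 2 ^ j < norm (step_fun A c x)}"
        unfolding A_def by (rule step_image_superlevel[OF s j nc])
    qed (use r in \<open>auto intro: step_measurable\<close>)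
    also have "(\<Sum>j<m. ((1 / 2 ^ (k0 + 1) / 2 ^ j)\<^sup>2 * 4 ^ (k0 + j)) powr r)
        = real m * (1 / 4) powr r"
    proof -
      \<comment> \<open>Squared level times measure is the same for all blocks, so the sum is linear
        in \<open>m\<close>; the 1/4 is the square of the halved height.\<close>
      have "(1 / 2 ^ (k0 + 1) / 2 ^ j)\<^sup>2 * 4 ^ (k0 + j) = (1 / 4 :: real)" for j
      proof -
        have "(1 / 2 ^ (k0 + 1) / 2 ^ j)\<^sup>2 = (1 / (4 * 4 ^ (k0 + j)) :: real)"
          by (simp add: power_add power2_eq_square power_mult_distrib[symmetric] field_simps)
        then show ?thesis by simp
      qed
      then show ?thesis by (simp only: sum_constant card_lessThan)
    qed
    also have "qnorm_pow (2 * r) {0<..} (step_fun A c)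
        \<le> ennreal K * qnorm_pow (2 * r) {0<..<1} (F A c)"
      unfolding QF[OF A] using A r by (intro le2 step_in_L2q)
    also have "\<dots> \<le> ennreal K * (ennreal (4 powr r / r) * (1 + (\<Sum>k. ennreal (?x k))))"
      by (intro mult_left_mono qnorm_pow_upper_unit r) auto
    also have "\<dots> = ennreal (K * (4 powr r / r)) * (1 + (\<Sum>k. ennreal (?x k)))"
    proof -
      have "ennreal (K * (4 powr r / r)) = ennreal K * ennreal (4 powr r / r)"
        using K r by (intro ennreal_mult) auto
      then show ?thesis by (simp only: mult.assoc)
    qed
    finally have "ennreal (1 / (K * (4 powr r / r))) * ennreal (\<kappa> * (real m * (1 / 4) powr r)) \<le>
       ennreal (1 / (K * (4 powr r / r))) * (ennreal (K * (4 powr r / r)) * (1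
           + (\<Sum>k. ennreal (?x k))))"
      by (rule mult_left_mono) simp
    also have "\<dots> = 1 + (\<Sum>k. ennreal (?x k))"
      using K r by (simp add: mult.assoc[symmetric] flip: ennreal_mult)
    also have "ennreal (1 / (K * (4 powr r / r))) * ennreal (\<kappa> * (real m * (1 / 4) powr r))
        = ennreal (c1 * real m)"
      using K r \<kappa> by (simp add: c1_def mult_ac flip: ennreal_mult)
    finally have main: "ennreal (c1 * real m) \<le> 1 + (\<Sum>k. ennreal (?x k))" .
    have "\<forall>\<^sub>F n in sequentially. c1 / 2 * real m \<le> 1 + (\<Sum>k<n. ?x k)"
    \<comment> \<open>For \<open>m = 0\<close> the strict inequality between
      \<open>c1 / 2 * m\<close> and \<open>c1 * m\<close> fails.\<close>
    proof (cases "m = 0")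
      case True
      then show ?thesis by (simp add: sum_nonneg add_nonneg_nonneg)
    next
      case False
      then show ?thesis
        using c1 by (intro eventually_partial_sums[OF _ main]) auto
    qed
    then show "\<forall>\<^sub>F n in sequentially. c1 / 2 * real m \<le> 1 + (\<Sum>k<n. (4 ^ k * tail ?M
        (\<lambda>t. \<Sum>x\<in>?P. (e x / 2 ^ (k0 + fst x)) *\<^sub>R f (s x) t) (2 ^ k)) powr r)"
      unfolding eq .
  qed
qed

theorem corollary6p12:
  fixes q :: real
  assumes "0 < q" and "q \<le> 1"
  shows "(\<nexists>T :: (real \<Rightarrow> real) \<Rightarrow> (real \<Rightarrow> real). L2q_embedding q {0<..} {0<..<1} T) \<and>
         (\<nexists>T :: (real \<Rightarrow> complex) \<Rightarrow> (real \<Rightarrow> complex). L2q_embedding q {0<..} {0<..<1} T)"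
  using assms no_L2q_embedding[where 'a = real, of "q / 2"]
    no_L2q_embedding[where 'a = complex, of "q / 2"]
  by simp

end
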